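(* Let $\Omega\subset\mathbb C$ be a domain and let $h\in\mathscr W^{1,2}_{\mathrm{loc}}(\Omega)$ be Hopf harmonic. Then for every $\eta\in\mathscr C_0^\infty(\Omega)$, $$\frac12\int_\Omega\left(|h_\xi|^2+|h_{\bar\xi}|^2\right)|\eta_{\bar\xi}|^2\,\mathbf{d}\xi\;+\;\operatorname{Re}\int_\Omega h_\xi\,\overline{h_{\bar\xi}}\;\eta_\xi\,\eta_{\bar\xi}\,\mathbf{d}\xi\;\geqslant\;0 .$$
   Context: $\xi$ denotes the complex variable in $\Omega$, $\mathbf{d}\xi$ the area element (Lebesgue measure), and the subscripts $\xi,\bar\xi$ denote the complex derivatives $\partial/\partial\xi=\frac12(\partial_x-i\partial_y)$, $\partial/\partial\bar\xi=\frac12(\partial_x+i\partial_y)$. Functions in $\mathscr C_0^\infty(\Omega)$ are complex valued, smooth, with compact support in $\Omega$. A complex-valued $h\in\mathscr W^{1,2}_{\mathrm{loc}}(\Omega)$ is Hopf harmonic if $\frac{\partial}{\partial\bar\xi}\big(h_\xi\,\overline{h_{\bar\xi}}\big)=0$ in the sense of distributions, i.e. $h_\xi\overline{h_{\bar\xi}}$ is holomorphic in $\Omega$. *)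

theory Defs
  imports "HOL-Analysis.Analysis"
begin

text \<open>Directional derivatives in the directions \<open>1\<close> and \<open>\<i>\<close> are the real partial
  derivatives \<open>\<partial>/\<partial>x\<close> and \<open>\<partial>/\<partial>y\<close>.\<close>

definition dir_deriv :: "complex \<Rightarrow> (complex \<Rightarrow> complex) \<Rightarrow> complex \<Rightarrow> complex" where
  "dir_deriv v f z = frechet_derivative f (at z) v"

definition d_xi :: "(complex \<Rightarrow> complex) \<Rightarrow> complex \<Rightarrow> complex" where
  "d_xi f z = (dir_deriv 1 f z - \<i> * dir_deriv \<i> f z) / 2"

definition d_xibar :: "(complex \<Rightarrow> complex) \<Rightarrow> complex \<Rightarrow> complex" where
  "d_xibar f z = (dir_deriv 1 f z + \<i> * dir_deriv \<i> f z) / 2"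

text \<open>Differentiability is over the reals: \<open>differentiable\<close> refers to the Frechet derivative,
  not to complex differentiability.\<close>

primrec C_k :: "nat \<Rightarrow> (complex \<Rightarrow> complex) \<Rightarrow> bool" where
  "C_k 0 f \<longleftrightarrow> continuous_on UNIV f"
| "C_k (Suc k) f \<longleftrightarrow>
     (\<forall>z. f differentiable (at z)) \<and> C_k k (dir_deriv 1 f) \<and> C_k k (dir_deriv \<i> f)"

text \<open>Elements of \<open>C_0^\<infinity>(\<Omega>)\<close> are represented by their extension by zero to the whole plane.\<close>

definition test_functions :: "complex set \<Rightarrow> (complex \<Rightarrow> complex) set" where
  "test_functions \<Omega> =
     {f. (\<forall>k. C_k k f) \<and> compact (closure {z. f z \<noteq> 0}) \<and> closure {z. f z \<noteq> 0} \<subseteq> \<Omega>}"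

definition L1_loc :: "complex set \<Rightarrow> (complex \<Rightarrow> complex) set" where
  "L1_loc \<Omega> = {f \<in> borel_measurable (lebesgue_on \<Omega>).
     \<forall>K. compact K \<and> K \<subseteq> \<Omega> \<longrightarrow> integrable (lebesgue_on K) f}"

definition L2_loc :: "complex set \<Rightarrow> (complex \<Rightarrow> complex) set" where
  "L2_loc \<Omega> = {f \<in> borel_measurable (lebesgue_on \<Omega>).
     \<forall>K. compact K \<and> K \<subseteq> \<Omega> \<longrightarrow> integrable (lebesgue_on K) (\<lambda>z. (cmod (f z))\<^sup>2)}"

definition has_weak_deriv ::
    "complex set \<Rightarrow> complex \<Rightarrow> (complex \<Rightarrow> complex) \<Rightarrow> (complex \<Rightarrow> complex) \<Rightarrow> bool" where
  "has_weak_deriv \<Omega> v f g \<longleftrightarrow> f \<in> L1_loc \<Omega> \<and> g \<in> L1_loc \<Omega> \<and>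
     (\<forall>\<psi>\<in>test_functions \<Omega>.
        (LINT z|lebesgue_on \<Omega>. f z * dir_deriv v \<psi> z) = - (LINT z|lebesgue_on \<Omega>. g z * \<psi> z))"

text \<open>For open \<open>\<Omega>\<close> a weak derivative is determined almost everywhere in \<open>\<Omega>\<close>; the choice
  operator picks a representative.\<close>

definition weak_deriv :: "complex set \<Rightarrow> complex \<Rightarrow> (complex \<Rightarrow> complex) \<Rightarrow> complex \<Rightarrow> complex" where
  "weak_deriv \<Omega> v f = (SOME g. has_weak_deriv \<Omega> v f g)"

definition weak_d_xi :: "complex set \<Rightarrow> (complex \<Rightarrow> complex) \<Rightarrow> complex \<Rightarrow> complex" where
  "weak_d_xi \<Omega> f z = (weak_deriv \<Omega> 1 f z - \<i> * weak_deriv \<Omega> \<i> f z) / 2"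

definition weak_d_xibar :: "complex set \<Rightarrow> (complex \<Rightarrow> complex) \<Rightarrow> complex \<Rightarrow> complex" where
  "weak_d_xibar \<Omega> f z = (weak_deriv \<Omega> 1 f z + \<i> * weak_deriv \<Omega> \<i> f z) / 2"

definition W12_loc :: "complex set \<Rightarrow> (complex \<Rightarrow> complex) set" where
  "W12_loc \<Omega> = {f \<in> L2_loc \<Omega>.
     \<forall>v\<in>{1, \<i>}. (\<exists>g. has_weak_deriv \<Omega> v f g) \<and> weak_deriv \<Omega> v f \<in> L2_loc \<Omega>}"

text \<open>The second conjunct says that the \<open>\<xi>\<close>-bar derivative of the Hopf product, a locally
  integrable function, vanishes as a distribution on \<open>\<Omega>\<close>.\<close>

definition hopf_harmonic :: "complex set \<Rightarrow> (complex \<Rightarrow> complex) \<Rightarrow> bool" where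
  "hopf_harmonic \<Omega> h \<longleftrightarrow> h \<in> W12_loc \<Omega> \<and>
     (\<forall>\<psi>\<in>test_functions \<Omega>.
        (LINT z|lebesgue_on \<Omega>. weak_d_xi \<Omega> h z * cnj (weak_d_xibar \<Omega> h z) * d_xibar \<psi> z) = 0)"

end

theory Submission
  imports Defs "HOL-Complex_Analysis.Complex_Analysis"
begin

text \<open>Write \<open>\<phi> = h_xi cnj h_xibar\<close>. Since \<open>2 |\<phi>|\<close> is at most the sum of the squared moduli of
  the derivatives of \<open>h\<close>, it suffices to bound \<open>|\<integral> \<phi> \<eta>_xi \<eta>_xibar|\<close> by \<open>\<integral> |\<phi>| |\<eta>_xibar|\<^sup>2\<close>.
  Both sides are continuous in \<open>\<phi>\<close> for the \<open>L\<^sup>1\<close> norm on a neighbourhood of the support of \<open>\<eta>\<close>, and a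
  mollification of the weakly holomorphic \<open>\<phi>\<close> is holomorphic there; so \<open>\<phi>\<close> may be taken holomorphic.

  If \<open>\<phi>\<close> had a holomorphic square root \<open>\<psi>\<close>, the bound would be the Cauchy-Schwarz inequality for the two
  derivatives of \<open>\<psi> \<eta>\<close>, which have the same \<open>L\<^sup>2\<close> norm. In general one replaces \<open>|\<psi>|\<^sup>2\<close> by the weight
  \<open>w = sqrt (|\<phi>|\<^sup>2 + \<epsilon>\<^sup>2)\<close> and \<open>(\<psi> \<eta>)_xi\<close> by \<open>A = \<eta>_xi + (w_xi / w) \<eta>\<close>. As \<open>log w\<close> is subharmonic,
  integration by parts gives \<open>\<integral> w |A|\<^sup>2 \<le> \<integral> w |\<eta>_xibar|\<^sup>2\<close>, with a surplus that absorbs the error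
  made by the regularization; then \<open>\<epsilon> \<rightarrow> 0\<close>.\<close>

text \<open>With a root \<psi> one has \<open>(\<psi> \<eta>)_xi (\<psi> \<eta>)_xibar = \<phi>
  \<eta>_xi \<eta>_xibar + \<phi>' \<eta> \<eta>_xibar / 2\<close>, and the last term, the xibar
  derivative of \<open>\<phi>' \<eta>^2 / 4\<close>, integrates to zero. Zeros of odd order and
  holes in the neighbourhood can prevent \<psi> from existing. Yet \<open>(\<psi> \<eta>)_xi /
  \<psi> = \<eta>_xi + (\<psi>' / \<psi>) \<eta>\<close> involves only
  \<open>\<psi>' / \<psi>\<close>, the xi derivative of \<open>log |\<phi>|\<close>, which is single
  valued and singular only at the zeros of \<phi>. Replacing \<open>|\<phi>|\<close> by
  \<open>w\<close> removes this singularity. The price is that \<open>\<phi> w_xi / w\<close>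
  differs from \<open>\<phi>' / 2\<close> by \<open>\<epsilon>^2 \<phi>' / (2 w^2)\<close>, which is
  not small near the zeros. The gain is that \<open>w\<close> times the mixed second derivative of
  \<open>log w\<close> is \<open>\<epsilon>^2 |\<phi>'|^2 / (2 w^3)\<close>, concentrated at the
  same places. The two are balanced: the error is at most half of this surplus, weighted by
  \<open>|\<eta>|^2\<close>, plus \<open>\<epsilon> / 4 |\<eta>_xibar|^2\<close>.\<close>

section \<open>Integration by parts for compactly supported functions\<close>

text \<open>\<open>p\<close> and \<open>q\<close> are the \<open>\<xi>\<close> and \<open>\<xi>\<close>-bar derivatives of the compactly supported \<open>F\<close>.\<close>

definition C1c :: "(complex \<Rightarrow> complex) \<Rightarrow> (complex \<Rightarrow> complex) \<Rightarrow> (complex \<Rightarrow> complex) \<Rightarrow> bool" where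
  "C1c F p q \<longleftrightarrow> continuous_on UNIV p \<and> continuous_on UNIV q \<and>
     (\<forall>z. (F has_derivative (\<lambda>h. p z * h + q z * cnj h)) (at z)) \<and>
     (\<exists>S. compact S \<and> (\<forall>z. z \<notin> S \<longrightarrow> F z = 0))"

lemma wirtinger_unique:
  assumes "(f has_derivative (\<lambda>h. p * h + q * cnj h)) (at z)"
    and "(f has_derivative (\<lambda>h. r * h + s * cnj h)) (at z)"
  shows "p = r \<and> q = s"
proof -
  have eq: "(\<lambda>h. p * h + q * cnj h) = (\<lambda>h. r * h + s * cnj h)"
    using assms by (rule has_derivative_unique)
  from fun_cong[OF eq, of 1] have 1: "p + q = r + s" by simp
  from fun_cong[OF eq, of \<i>] have "\<i> * (p - q) = \<i> * (r - s)"
    by (simp add: algebra_simps)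
  hence 2: "p - q = r - s" by simp
  have "2 * p = (p + q) + (p - q)" by simp
  also have "\<dots> = 2 * r" unfolding 1 2 by simp
  finally have "p = r" by simp
  with 1 show ?thesis by simp
qed

lemma has_derivative_zero_outside:
  assumes "closed S" and "\<And>z. z \<notin> S \<Longrightarrow> F z = 0" and "z \<notin> S"
  shows "(F has_derivative (\<lambda>h. 0)) (at z)"
proof (rule has_derivative_transform_within_open)
  show "((\<lambda>z. 0) has_derivative (\<lambda>h. 0)) (at z)" by simp
  show "open (-S)" "z \<in> -S" using assms by auto
qed (use assms in auto)

lemma wirtinger_zero_outside:
  fixes F :: "complex \<Rightarrow> complex"
  assumes "closed S" and "\<And>z. z \<notin> S \<Longrightarrow> F z = 0" and "z \<notin> S"
    and "(F has_derivative (\<lambda>h. p * h + q * cnj h)) (at z)"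
  shows "p = 0 \<and> q = 0"
proof -
  have "(F has_derivative (\<lambda>h. 0 * h + 0 * cnj h)) (at z)"
    using has_derivative_zero_outside[OF assms(1-3)] by simp
  from wirtinger_unique[OF assms(4) this] show ?thesis by simp
qed

lemma integrable_continuous_compact_support:
  fixes f :: "complex \<Rightarrow> 'b::{banach, second_countable_topology}"
  assumes "continuous_on UNIV f" and "compact S" and "\<And>z. z \<notin> S \<Longrightarrow> f z = 0"
  shows "integrable lborel f"
proof -
  have "integrable lborel (\<lambda>x. indicator S x *\<^sub>R f x)"
    using assms(1,2) by (intro borel_integrable_compact) (auto intro: continuous_on_subset)
  moreover have "(\<lambda>x. indicator S x *\<^sub>R f x) = f"
    using assms(3) by (auto simp: indicator_def)
  ultimately show ?thesis by simp
qed

lemma bounded_compact_support: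
  fixes f :: "complex \<Rightarrow> 'b::real_normed_vector"
  assumes "continuous_on UNIV f" and "compact S" and "\<And>z. z \<notin> S \<Longrightarrow> f z = 0"
  obtains M where "M \<ge> 0" and "\<And>z. norm (f z) \<le> M"
proof -
  have "compact (f ` S)"
    using assms(1,2) by (intro compact_continuous_image) (auto intro: continuous_on_subset)
  then obtain M where M: "\<And>x. x \<in> S \<Longrightarrow> norm (f x) \<le> M"
    using compact_imp_bounded by (fastforce simp: bounded_iff)
  show thesis
  proof (rule that)
    show "norm (f z) \<le> max M 0" for z
      using M[of z] assms(3)[of z] by (cases "z \<in> S") auto
  qed auto
qed

lemma C1c_continuous: "C1c F p q \<Longrightarrow> continuous_on UNIV F"
  unfolding C1c_def continuous_on_eq_continuous_at[OF open_UNIV]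
  using has_derivative_continuous by blast

text \<open>The compact set in \<open>C1c\<close> only supports \<open>F\<close>; its complement is
  open, so uniqueness of the derivative makes \<open>p\<close> and \<open>q\<close> vanish there
  too.\<close>

lemma C1c_support:
  assumes "C1c F p q"
  obtains S where "compact S" and "\<And>z. z \<notin> S \<Longrightarrow> F z = 0"
    and "\<And>z. z \<notin> S \<Longrightarrow> p z = 0" and "\<And>z. z \<notin> S \<Longrightarrow> q z = 0"
proof -
  from assms obtain S where S: "compact S" "\<And>z. z \<notin> S \<Longrightarrow> F z = 0"
    and d: "\<And>z. (F has_derivative (\<lambda>h. p z * h + q z * cnj h)) (at z)"
    unfolding C1c_def by blast
  have "p z = 0 \<and> q z = 0" if "z \<notin> S" for z
    using wirtinger_zero_outside[OF compact_imp_closed[OF S(1)] S(2) that d] .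
  with S that show thesis by blast
qed

text \<open>Serves to dominate difference quotients in limits under the integral sign.\<close>

lemma C1c_lipschitz:
  assumes "C1c F p q"
  obtains M where "M \<ge> 0" and "\<And>z w. norm (F z - F w) \<le> M * norm (z - w)"
proof -
  from C1c_support[OF assms] obtain S where S: "compact S" "\<And>z. z \<notin> S \<Longrightarrow> F z = 0"
    "\<And>z. z \<notin> S \<Longrightarrow> p z = 0" "\<And>z. z \<notin> S \<Longrightarrow> q z = 0" by metis
  have c: "continuous_on UNIV p" "continuous_on UNIV q"
    and d: "\<And>z. (F has_derivative (\<lambda>h. p z * h + q z * cnj h)) (at z)"
    using assms unfolding C1c_def by auto
  obtain A where A: "A \<ge> 0" "\<And>z. norm (p z) \<le> A" using bounded_compact_support[OF c(1) S(1,3)] by metis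
  obtain B where B: "B \<ge> 0" "\<And>z. norm (q z) \<le> B" using bounded_compact_support[OF c(2) S(1,4)] by metis
  have "onorm (\<lambda>h. p z * h + q z * cnj h) \<le> A + B" for z
  proof (rule onorm_bound)
    show "norm (p z * h + q z * cnj h) \<le> (A + B) * norm h" for h
    proof -
      have "norm (p z * h + q z * cnj h) \<le> norm (p z) * norm h + norm (q z) * norm h"
        by (metis complex_mod_cnj norm_mult norm_triangle_ineq)
      also have "\<dots> \<le> A * norm h + B * norm h"
        using A(2)[of z] B(2)[of z] by (intro add_mono mult_right_mono) auto
      finally show ?thesis by (simp add: algebra_simps)
    qed
  qed (use A B in auto)
  hence "norm (F z - F w) \<le> (A + B) * norm (z - w)" for z w
    by (intro differentiable_bound[of UNIV F "\<lambda>z h. p z * h + q z * cnj h"]) (use d in auto)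
  thus thesis using that[of "A + B"] A B by auto
qed

section \<open>Translation invariance and central difference quotients\<close>

lemma integral_translate:
  fixes f :: "'a::euclidean_space \<Rightarrow> 'b::{banach, second_countable_topology}"
  assumes [measurable]: "f \<in> borel_measurable borel"
  shows "(LINT z|lborel. f (z + c)) = (LINT z|lborel. f z)"
proof -
  have "(LINT z|lborel. f z) = (LINT z|distr lborel borel ((+) c). f z)"
    by (simp add: lborel_distr_plus)
  also have "\<dots> = (LINT z|lborel. f (c + z))"
    by (subst integral_distr) auto
  finally show ?thesis by (simp add: add.commute)
qed

lemma integrable_translate:
  fixes f :: "'a::euclidean_space \<Rightarrow> 'b::{banach, second_countable_topology}"
  assumes "integrable lborel f"
  shows "integrable lborel (\<lambda>z. f (z + c))"
proof -
  have "integrable (distr lborel borel ((+) c)) f"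
    using assms by (simp add: lborel_distr_plus)
  hence "integrable lborel (\<lambda>z. f (c + z))"
    by (subst (asm) integrable_distr_eq) (use assms in auto)
  thus ?thesis by (simp add: add.commute)
qed

lemma vector_derivative_quotient:
  fixes g :: "real \<Rightarrow> 'a::real_normed_vector"
  assumes "(g has_vector_derivative L) (at 0)" and "g 0 = 0"
  shows "((\<lambda>t. g t /\<^sub>R t) \<longlongrightarrow> L) (at 0)"
proof -
  have "((\<lambda>t. norm (g t - t *\<^sub>R L) / norm t) \<longlongrightarrow> 0) (at 0)"
    using assms unfolding has_vector_derivative_def has_derivative_at by simp
  moreover have "\<forall>\<^sub>F t in at 0. norm (g t - t *\<^sub>R L) / norm t = norm (g t /\<^sub>R t - L)"
  proof (rule eventually_at_filter[THEN iffD2, OF always_eventually], safe)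
    fix t :: real assume "t \<noteq> 0"
    hence "g t /\<^sub>R t - L = (g t - t *\<^sub>R L) /\<^sub>R t" by (simp add: scaleR_diff_right)
    thus "norm (g t - t *\<^sub>R L) / norm t = norm (g t /\<^sub>R t - L)" by (simp add: divide_inverse mult.commute)
  qed
  ultimately have "((\<lambda>t. norm (g t /\<^sub>R t - L)) \<longlongrightarrow> 0) (at 0)"
    by (rule Lim_transform_eventually)
  thus ?thesis by (subst Lim_null[of "\<lambda>t. g t /\<^sub>R t"]) (rule tendsto_norm_zero_cancel)
qed

text \<open>Central differences are taken because for them the exchange of directions in
  \<open>integral_sym_diff_commute\<close> is exact. With forward differences
  \<open>F (z + a) - F z\<close> the two sides would be sums over different shifts.\<close>

definition sym_diff :: "complex \<Rightarrow> (complex \<Rightarrow> complex) \<Rightarrow> complex \<Rightarrow> complex" where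
  "sym_diff a F z = F (z + a) - F (z - a)"

lemma C1c_sym_diff_limit:
  assumes "C1c F p q"
  shows "(\<lambda>n. sym_diff (v /\<^sub>R real (Suc n)) F z * (real (Suc n) / 2)) \<longlonglongrightarrow> p z * v + q z * cnj v"
proof -
  have d: "(F has_derivative (\<lambda>h. p z * h + q z * cnj h)) (at z)"
    using assms unfolding C1c_def by auto
  have v1: "((\<lambda>t::real. F (z + t *\<^sub>R v)) has_vector_derivative (p z * v + q z * cnj v)) (at 0)"
    unfolding has_vector_derivative_def
  proof (rule has_derivative_eq_rhs)
    show "((\<lambda>t::real. F (z + t *\<^sub>R v)) has_derivative (\<lambda>t. p z * (t *\<^sub>R v) + q z * cnj (t *\<^sub>R v))) (at 0)"
      by (rule has_derivative_compose[of "\<lambda>t. z + t *\<^sub>R v" "\<lambda>t. t *\<^sub>R v" 0 UNIV F "\<lambda>h. p z * h + q z * cnj h"])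
         (auto intro!: derivative_eq_intros simp: d)
  qed (auto simp: algebra_simps)
  have v2: "((\<lambda>t::real. F (z - t *\<^sub>R v)) has_vector_derivative - (p z * v + q z * cnj v)) (at 0)"
    unfolding has_vector_derivative_def
  proof (rule has_derivative_eq_rhs)
    show "((\<lambda>t::real. F (z - t *\<^sub>R v)) has_derivative (\<lambda>t. p z * (- t *\<^sub>R v) + q z * cnj (- t *\<^sub>R v))) (at 0)"
      by (rule has_derivative_compose[of "\<lambda>t. z - t *\<^sub>R v" "\<lambda>t. - t *\<^sub>R v" 0 UNIV F "\<lambda>h. p z * h + q z * cnj h"])
         (auto intro!: derivative_eq_intros simp: d)
  qed (auto simp: algebra_simps)
  have "((\<lambda>t::real. F (z + t *\<^sub>R v) - F (z - t *\<^sub>R v)) has_vector_derivative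
      2 * (p z * v + q z * cnj v)) (at 0)"
    using has_vector_derivative_diff[OF v1 v2] by (simp add: algebra_simps)
  hence "((\<lambda>t::real. (F (z + t *\<^sub>R v) - F (z - t *\<^sub>R v)) /\<^sub>R t) \<longlongrightarrow> 2 * (p z * v + q z * cnj v)) (at 0)"
    by (rule vector_derivative_quotient) simp
  moreover have "filterlim (\<lambda>n. inverse (real (Suc n))) (at 0) sequentially"
    using LIMSEQ_inverse_real_of_nat by (auto simp: filterlim_at simp del: of_nat_Suc)
  ultimately have "(\<lambda>n. (F (z + inverse (real (Suc n)) *\<^sub>R v) - F (z - inverse (real (Suc n)) *\<^sub>R v))
      /\<^sub>R inverse (real (Suc n))) \<longlonglongrightarrow> 2 * (p z * v + q z * cnj v)"
    by (rule filterlim_compose)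
  hence "(\<lambda>n. (F (z + inverse (real (Suc n)) *\<^sub>R v) - F (z - inverse (real (Suc n)) *\<^sub>R v))
      /\<^sub>R inverse (real (Suc n)) / 2) \<longlonglongrightarrow> 2 * (p z * v + q z * cnj v) / 2"
    by (intro tendsto_divide) auto
  moreover have eq: "(F (z + inverse (real (Suc n)) *\<^sub>R v) - F (z - inverse (real (Suc n)) *\<^sub>R v))
      /\<^sub>R inverse (real (Suc n)) / 2 = sym_diff (v /\<^sub>R real (Suc n)) F z * (real (Suc n) / 2)" for n
    by (simp add: sym_diff_def scaleR_conv_of_real)
  moreover have rhs: "2 * (p z * v + q z * cnj v) / 2 = p z * v + q z * cnj v" by simp
  ultimately show ?thesis unfolding eq rhs by simp
qed

lemma C1c_sym_diff:
  assumes "C1c F p q"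
  obtains M R where "M \<ge> 0"
    and "\<And>a z. norm (sym_diff a F z) \<le> M * norm a"
    and "\<And>a z. norm a \<le> 1 \<Longrightarrow> z \<notin> cball 0 R \<Longrightarrow> sym_diff a F z = 0"
proof -
  from C1c_support[OF assms] obtain S where S: "compact S" "\<And>z. z \<notin> S \<Longrightarrow> F z = 0" by metis
  then obtain R0 where R0: "\<And>z. z \<in> S \<Longrightarrow> norm z \<le> R0"
    using compact_imp_bounded bounded_iff by metis
  obtain L where L: "L \<ge> 0" "\<And>z w. norm (F z - F w) \<le> L * norm (z - w)"
    using C1c_lipschitz[OF assms] by metis
  show thesis
  proof (rule that[of "2 * L" "R0 + 1"])
    show "norm (sym_diff a F z) \<le> 2 * L * norm a" for a z
    proof -
      have "(z + a) - (z - a) = 2 * a" by simp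
      hence "norm ((z + a) - (z - a)) = 2 * norm a" by (simp add: norm_mult)
      thus ?thesis using L(2)[of "z + a" "z - a"] by (simp add: sym_diff_def)
    qed
    show "sym_diff a F z = 0" if "norm a \<le> 1" "z \<notin> cball 0 (R0 + 1)" for a z
    proof -
      have "norm z > R0 + 1" using that by simp
      hence "norm (z + a) > R0" "norm (z - a) > R0"
        using that norm_triangle_ineq2[of z "-a"] norm_triangle_ineq2[of z a] by auto
      hence "z + a \<notin> S" "z - a \<notin> S" using R0 by force+
      thus ?thesis using S(2) by (simp add: sym_diff_def)
    qed
  qed (use L in auto)
qed


text \<open>One constant and one ball for all \<open>n\<close>: they give the majorant
  \<open>M * indicator (cball 0 R)\<close> for dominated convergence. The bound on \<open>v\<close>
  keeps all steps of size at most 1, so the supports stay in one ball.\<close>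

lemma C1c_difference_quotients:
  assumes "C1c F p q" and "norm v \<le> 1"
  obtains M R where "\<And>n z. norm (sym_diff (v /\<^sub>R real (Suc n)) F z * (real (Suc n) / 2)) \<le> M"
    "\<And>n z. z \<notin> cball 0 R \<Longrightarrow> sym_diff (v /\<^sub>R real (Suc n)) F z = 0" "M \<ge> 0"
proof -
  obtain M R where M: "M \<ge> 0" and b: "\<And>a z. norm (sym_diff a F z) \<le> M * norm a"
    and s: "\<And>a z. norm a \<le> 1 \<Longrightarrow> z \<notin> cball 0 R \<Longrightarrow> sym_diff a F z = 0"
    using C1c_sym_diff[OF assms(1)] by metis
  show thesis
  proof (rule that[of M R])
    fix n z
    have "norm (sym_diff (v /\<^sub>R real (Suc n)) F z) \<le> M * norm (v /\<^sub>R real (Suc n))" by (rule b)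
    also have "\<dots> = M * norm v / real (Suc n)" by (simp add: divide_inverse)
    also have "\<dots> \<le> M * 1 / real (Suc n)"
      using M assms(2) by (intro divide_right_mono mult_left_mono) auto
    finally have "norm (sym_diff (v /\<^sub>R real (Suc n)) F z) * real (Suc n) \<le> M"
      by (simp add: field_simps)
    thus "norm (sym_diff (v /\<^sub>R real (Suc n)) F z * (real (Suc n) / 2)) \<le> M"
      using M by (simp add: norm_mult norm_divide del: of_nat_Suc)
    have "norm (v /\<^sub>R real (Suc n)) \<le> 1"
      using assms(2) by (simp add: field_simps)
    thus "sym_diff (v /\<^sub>R real (Suc n)) F z = 0" if "z \<notin> cball 0 R" using s that by blast
  qed (use M in auto)
qed

lemma integrable_indicator_cball: "integrable lborel (\<lambda>z::complex. M * indicator (cball 0 R) z :: real)"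
  using emeasure_bounded_finite[of "cball (0::complex) R"]
  by (intro integrable_mult_right integrable_real_indicator) auto

lemma C1c_measurable: "C1c F p q \<Longrightarrow> F \<in> borel_measurable borel"
  using C1c_continuous borel_measurable_continuous_onI by blast

lemma C1c_measurable_deriv:
  assumes "C1c F p q"
  shows "p \<in> borel_measurable borel" and "q \<in> borel_measurable borel"
  using assms unfolding C1c_def by (auto intro: borel_measurable_continuous_onI)

lemma C1c_integrable:
  assumes "C1c F p q"
  shows "integrable lborel F" "integrable lborel p" "integrable lborel q"
proof -
  from C1c_support[OF assms] obtain S where S: "compact S" "\<And>z. z \<notin> S \<Longrightarrow> F z = 0"
    "\<And>z. z \<notin> S \<Longrightarrow> p z = 0" "\<And>z. z \<notin> S \<Longrightarrow> q z = 0" by metis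
  show "integrable lborel F" "integrable lborel p" "integrable lborel q"
    using assms integrable_continuous_compact_support[OF _ S(1)] S C1c_continuous[OF assms]
    unfolding C1c_def by auto
qed

text \<open>The integral of each \<open>sym_diff a F\<close> vanishes by translation invariance, and
  the directional derivative is a dominated limit of rescaled differences. This replaces the
  fundamental theorem of calculus along lines.\<close>

lemma C1c_integral_directional:
  assumes "C1c F p q" and "norm v \<le> 1"
  shows "(LINT z|lborel. p z * v + q z * cnj v) = 0"
proof -
  note [measurable] = C1c_measurable[OF assms(1)] C1c_measurable_deriv[OF assms(1)]
  obtain M R where MR: "\<And>n z. norm (sym_diff (v /\<^sub>R real (Suc n)) F z * (real (Suc n) / 2)) \<le> M"
    "\<And>n z. z \<notin> cball 0 R \<Longrightarrow> sym_diff (v /\<^sub>R real (Suc n)) F z = 0" "M \<ge> 0"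
    by (rule C1c_difference_quotients[OF assms]) (rule that)
  have lim: "(\<lambda>n. sym_diff (v /\<^sub>R real (Suc n)) F z * (real (Suc n) / 2)) \<longlonglongrightarrow> p z * v + q z * cnj v" for z
    by (rule C1c_sym_diff_limit[OF assms(1)])
  have "(\<lambda>n. LINT z|lborel. sym_diff (v /\<^sub>R real (Suc n)) F z * (real (Suc n) / 2))
      \<longlonglongrightarrow> (LINT z|lborel. p z * v + q z * cnj v)"
  proof (rule integral_dominated_convergence)
    show "integrable lborel (\<lambda>z::complex. M * indicator (cball 0 R) z :: real)"
      by (rule integrable_indicator_cball)
    show "AE z in lborel. norm (sym_diff (v /\<^sub>R real (Suc n)) F z * (real (Suc n) / 2)) \<le> M * indicator (cball 0 R) z" for n
    proof (rule AE_I2)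
      fix z :: complex
      show "norm (sym_diff (v /\<^sub>R real (Suc n)) F z * (real (Suc n) / 2)) \<le> M * indicator (cball 0 R) z"
        using MR(1)[of n z] MR(2)[of z n] by (cases "z \<in> cball 0 R") (auto simp del: of_nat_Suc)
    qed
    show "(\<lambda>z. sym_diff (v /\<^sub>R real (Suc n)) F z * (real (Suc n) / 2)) \<in> borel_measurable lborel" for n
      unfolding sym_diff_def by measurable
    show "(\<lambda>z. p z * v + q z * cnj v) \<in> borel_measurable lborel" by measurable
  qed (use lim in auto)
  moreover have "(LINT z|lborel. sym_diff a F z) = 0" for a
  proof -
    have "integrable lborel (\<lambda>z. F (z + a))" "integrable lborel (\<lambda>z. F (z - a))"
      using integrable_translate[OF C1c_integrable(1)[OF assms(1)], of a]
        integrable_translate[OF C1c_integrable(1)[OF assms(1)], of "-a"] by simp_all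
    thus ?thesis using integral_translate[of F a] integral_translate[of F "-a"]
      by (simp add: sym_diff_def)
  qed
  ultimately show ?thesis by (simp add: LIMSEQ_const_iff)
qed

lemma C1c_integral_deriv_eq_0:
  assumes "C1c F p q"
  shows "(LINT z|lborel. p z) = 0" and "(LINT z|lborel. q z) = 0"
proof -
  note I = C1c_integrable(2,3)[OF assms]
  have 1: "(LINT z|lborel. p z) + (LINT z|lborel. q z) = 0"
    using C1c_integral_directional[OF assms, of 1] I by simp
  have "(LINT z|lborel. p z) * \<i> - (LINT z|lborel. q z) * \<i> = 0"
    using C1c_integral_directional[OF assms, of \<i>] I by simp
  hence "((LINT z|lborel. p z) - (LINT z|lborel. q z)) * \<i> = 0" by (simp only: left_diff_distrib)
  hence 2: "(LINT z|lborel. p z) = (LINT z|lborel. q z)" by simp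
  show "(LINT z|lborel. p z) = 0" "(LINT z|lborel. q z) = 0" using 1 unfolding 2 by auto
qed

text \<open>Summation by parts on the level of differences: the usual proof of the limiting identity would
  need second derivatives of \<open>F\<close> or \<open>G\<close>.\<close>

lemma integral_sym_diff_commute:
  assumes F: "C1c F p q" and G: "C1c G r s"
  shows "(LINT z|lborel. sym_diff a F z * sym_diff b G z) = (LINT z|lborel. sym_diff b F z * sym_diff a G z)"
proof -
  note [measurable] = C1c_measurable[OF F] C1c_measurable[OF G]
  define I where "I c = (LINT z|lborel. F z * G (z + c))" for c
  obtain S where S: "compact S" "\<And>z. z \<notin> S \<Longrightarrow> F z = 0" using C1c_support[OF F] by metis
  have int: "integrable lborel (\<lambda>z. F z * G (z + c))" for c
  proof (rule integrable_continuous_compact_support[OF _ S(1)])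
    have "continuous_on UNIV (\<lambda>z. G (z + c))"
      by (rule continuous_on_compose2[OF C1c_continuous[OF G]]) (auto intro!: continuous_intros)
    thus "continuous_on UNIV (\<lambda>z. F z * G (z + c))"
      using C1c_continuous[OF F] by (intro continuous_on_mult)
  qed (use S in auto)
  have 1: "integrable lborel (\<lambda>z. F (z + c) * G (z + d))"
     "(LINT z|lborel. F (z + c) * G (z + d)) = I (d - c)" for c d
    using integrable_translate[OF int[of "d - c"], of c]
      integral_translate[of "\<lambda>z. F z * G (z + (d - c))" c]
    by (simp_all add: I_def add.assoc)
  \<comment> \<open>Exchanging \<open>a\<close> and \<open>b\<close> only permutes the four terms on
    the right.\<close>
  have exp: "(LINT z|lborel. sym_diff a F z * sym_diff b G z) = I (b - a) - I (- b - a) - I (b + a) + I (a - b)" for a b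
  proof -
    have "(LINT z|lborel. sym_diff a F z * sym_diff b G z) =
      (LINT z|lborel. F (z + a) * G (z + b) - F (z + a) * G (z + (- b)) - F (z + (- a)) * G (z + b)
        + F (z + (- a)) * G (z + (- b)))"
      by (intro Bochner_Integration.integral_cong) (auto simp: sym_diff_def algebra_simps)
    also have "\<dots> = I (b - a) - I (- b - a) - I (b - (-a)) + I (- b - (- a))"
      by (simp add: 1 del: add_uminus_conv_diff diff_minus_eq_add)
    finally show ?thesis by simp
  qed
  show ?thesis unfolding exp by (simp add: algebra_simps minus_diff_commute)
qed

text \<open>For smooth functions \<open>p s - q r\<close> is \<open>(F s)_xi - (F r)_xibar\<close>.
  Here the commutation of differences is passed to the limit in the directions 1 and \<i>, and
  \<open>(p + q) * \<i> * (r - s) - \<i> * (p - q) * (r + s) = 2 * \<i> * (q * r - p * s)\<close>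
  isolates the mixed products.\<close>

lemma C1c_integral_commute:
  assumes F: "C1c F p q" and G: "C1c G r s"
  shows "(LINT z|lborel. p z * s z) = (LINT z|lborel. q z * r z)"
proof -
  note [measurable] = C1c_measurable[OF F] C1c_measurable_deriv[OF F] C1c_measurable[OF G] C1c_measurable_deriv[OF G]
  let ?Q = "\<lambda>v n F z. sym_diff (v /\<^sub>R real (Suc n)) F z * (real (Suc n) / 2)"
  have lim: "(\<lambda>n. LINT z|lborel. ?Q u n F z * ?Q v n G z)
      \<longlonglongrightarrow> (LINT z|lborel. (p z * u + q z * cnj u) * (r z * v + s z * cnj v))"
    if u: "norm u \<le> 1" and v: "norm v \<le> 1" for u v
  proof -
    obtain M R where MR: "\<And>n z. norm (?Q u n F z) \<le> M"
      "\<And>n z. z \<notin> cball 0 R \<Longrightarrow> sym_diff (u /\<^sub>R real (Suc n)) F z = 0" "M \<ge> 0"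
      by (rule C1c_difference_quotients[OF F u]) (rule that)
    obtain M' R' where MR': "\<And>n z. norm (?Q v n G z) \<le> M'"
      "\<And>n z. z \<notin> cball 0 R' \<Longrightarrow> sym_diff (v /\<^sub>R real (Suc n)) G z = 0" "M' \<ge> 0"
      by (rule C1c_difference_quotients[OF G v]) (rule that)
    show ?thesis
    proof (rule integral_dominated_convergence)
      show "integrable lborel (\<lambda>z::complex. (M * M') * indicator (cball 0 R) z :: real)"
        by (rule integrable_indicator_cball)
      show "AE z in lborel. norm (?Q u n F z * ?Q v n G z) \<le> M * M' * indicator (cball 0 R) z" for n
      proof (rule AE_I2)
        fix z :: complex
        have "norm (?Q u n F z) * norm (?Q v n G z) \<le> M * M'"
          using MR(1)[of n z] MR(3) MR'(1)[of n z] MR'(3) by (intro mult_mono) (auto intro: order_trans[OF norm_ge_zero])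
        thus "norm (?Q u n F z * ?Q v n G z) \<le> M * M' * indicator (cball 0 R) z"
          using MR(2)[of z n] by (cases "z \<in> cball 0 R") (auto simp del: of_nat_Suc simp: norm_mult)
      qed
      have "(\<lambda>n. ?Q u n F z) \<longlonglongrightarrow> p z * u + q z * cnj u" for z
        by (rule C1c_sym_diff_limit[OF F])
      moreover have "(\<lambda>n. ?Q v n G z) \<longlonglongrightarrow> r z * v + s z * cnj v" for z
        by (rule C1c_sym_diff_limit[OF G])
      ultimately show "AE z in lborel. (\<lambda>n. ?Q u n F z * ?Q v n G z)
          \<longlonglongrightarrow> (p z * u + q z * cnj u) * (r z * v + s z * cnj v)"
        by (intro AE_I2 tendsto_mult)
      show "(\<lambda>z. ?Q u n F z * ?Q v n G z) \<in> borel_measurable lborel" for n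
        unfolding sym_diff_def by measurable
    qed measurable
  qed
  have "(LINT z|lborel. ?Q u n F z * ?Q v n G z) = (LINT z|lborel. ?Q v n F z * ?Q u n G z)" for u v n
  proof -
    have "(LINT z|lborel. ?Q u n F z * ?Q v n G z) =
      (LINT z|lborel. (real (Suc n) / 2)\<^sup>2 * (sym_diff (u /\<^sub>R real (Suc n)) F z * sym_diff (v /\<^sub>R real (Suc n)) G z))" for u v
      by (intro Bochner_Integration.integral_cong) (auto simp: power2_eq_square)
    thus ?thesis
      by (simp add: integral_sym_diff_commute[OF F G, of "u /\<^sub>R real (Suc n)"] del: of_nat_Suc)
  qed
  hence "(LINT z|lborel. (p z * 1 + q z * cnj 1) * (r z * \<i> + s z * cnj \<i>)) =
     (LINT z|lborel. (p z * \<i> + q z * cnj \<i>) * (r z * 1 + s z * cnj 1))"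
    using lim[of 1 \<i>] lim[of \<i> 1] by (intro LIMSEQ_unique[OF lim[of 1 \<i>]]) auto
  hence "(LINT z|lborel. \<i> * (p z * r z) - \<i> * (p z * s z) + \<i> * (q z * r z) - \<i> * (q z * s z)) =
     (LINT z|lborel. \<i> * (p z * r z) + \<i> * (p z * s z) - \<i> * (q z * r z) - \<i> * (q z * s z))"
    by (simp add: algebra_simps)
  moreover have "integrable lborel (\<lambda>z. f z * g z)" if "f \<in> {p, q}" "g \<in> {r, s}" for f g
  proof -
    obtain S where S: "compact S" "\<And>z. z \<notin> S \<Longrightarrow> F z = 0" "\<And>z. z \<notin> S \<Longrightarrow> p z = 0" "\<And>z. z \<notin> S \<Longrightarrow> q z = 0"
      using C1c_support[OF F] by metis
    show ?thesis
    proof (rule integrable_continuous_compact_support[OF _ S(1)])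
      show "continuous_on UNIV (\<lambda>z. f z * g z)"
        using that F G unfolding C1c_def by (auto intro!: continuous_on_mult)
    qed (use that S in auto)
  qed
  ultimately have "2 * \<i> * (LINT z|lborel. q z * r z) = 2 * \<i> * (LINT z|lborel. p z * s z)"
    by (simp add: algebra_simps)
  thus ?thesis by simp
qed

section \<open>The regularized pointwise estimate\<close>

lemma wirtinger_mult:
  assumes "(f has_derivative (\<lambda>h. p * h + q * cnj h)) (at z)"
    and "(g has_derivative (\<lambda>h. r * h + s * cnj h)) (at z)"
  shows "((\<lambda>z. f z * g z) has_derivative
    (\<lambda>h. (p * g z + f z * r) * h + (q * g z + f z * s) * cnj h)) (at z)"
proof -
  have "(\<lambda>h. f z * (r * h + s * cnj h) + (p * h + q * cnj h) * g z) =
    (\<lambda>h. (p * g z + f z * r) * h + (q * g z + f z * s) * cnj h)"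
    by (simp add: fun_eq_iff algebra_simps)
  with has_derivative_mult[OF assms] show ?thesis by (simp only:)
qed

lemma wirtinger_cnj:
  assumes "(f has_derivative (\<lambda>h. p * h + q * cnj h)) (at z)"
  shows "((\<lambda>z. cnj (f z)) has_derivative (\<lambda>h. cnj q * h + cnj p * cnj h)) (at z)"
  using has_derivative_cnj[OF assms] by (simp add: add.commute)

lemma wirtinger_holomorphic:
  assumes "(f has_field_derivative p) (at z)"
  shows "(f has_derivative (\<lambda>h. p * h + 0 * cnj h)) (at z)"
  using assms by (simp add: has_field_derivative_def)

lemma of_real_inner_complex: "of_real (a \<bullet> b) = (a * cnj b + cnj a * b) / 2" for a b :: complex
  by (simp add: complex_eq_iff inner_complex_def)

text \<open>Positivity of \<epsilon> keeps the argument of the root away from 0, so \<open>w\<close>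
  is differentiable even at zeros of \<open>f\<close>. As \<open>w\<close> is real, its two
  Wirtinger derivatives are conjugate.\<close>

lemma wirtinger_regularized_norm:
  fixes f :: "complex \<Rightarrow> complex"
  assumes f: "(f has_field_derivative f') (at z)" and "\<epsilon> > 0"
  defines "w \<equiv> \<lambda>z. sqrt ((cmod (f z))\<^sup>2 + \<epsilon>\<^sup>2)"
  shows "((\<lambda>z. complex_of_real (w z)) has_derivative
    (\<lambda>h. f' * cnj (f z) / (2 * of_real (w z)) * h + cnj (f' * cnj (f z) / (2 * of_real (w z))) * cnj h)) (at z)"
proof -
  have pos: "(cmod (f z))\<^sup>2 + \<epsilon>\<^sup>2 > 0"
    using \<open>\<epsilon> > 0\<close> by (simp add: add_nonneg_pos)
  have d: "(f has_derivative (\<lambda>h. f' * h)) (at z)"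
    using f by (simp add: has_field_derivative_def)
  have "((\<lambda>z. f z \<bullet> f z + \<epsilon>\<^sup>2) has_derivative (\<lambda>h. f z \<bullet> (f' * h) + (f' * h) \<bullet> f z + 0)) (at z)"
    by (intro has_derivative_add has_derivative_inner d has_derivative_const)
  hence "((\<lambda>z. (cmod (f z))\<^sup>2 + \<epsilon>\<^sup>2) has_derivative (\<lambda>h. 2 * (f z \<bullet> (f' * h)))) (at z)"
    by (simp add: power2_norm_eq_inner inner_commute)
  hence "(w has_derivative (\<lambda>h. 2 * (f z \<bullet> (f' * h)) * (inverse (w z) / 2))) (at z)"
    unfolding w_def
    by (rule DERIV_compose_FDERIV[where f=sqrt and g="\<lambda>z. (cmod (f z))\<^sup>2 + \<epsilon>\<^sup>2", OF DERIV_real_sqrt[OF pos]])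
  hence "((\<lambda>z. complex_of_real (w z)) has_derivative (\<lambda>h. of_real (2 * (f z \<bullet> (f' * h)) * (inverse (w z) / 2)))) (at z)"
    by (rule bounded_linear.has_derivative[OF bounded_linear_of_real])
  moreover have "w z \<noteq> 0" using pos unfolding w_def by (metis less_irrefl real_sqrt_eq_0_iff)
  moreover from this have "(\<lambda>h. complex_of_real (2 * (f z \<bullet> (f' * h)) * (inverse (w z) / 2))) =
     (\<lambda>h. f' * cnj (f z) / (2 * of_real (w z)) * h + cnj (f' * cnj (f z) / (2 * of_real (w z))) * cnj h)"
    by (simp add: of_real_inner_complex fun_eq_iff divide_simps)
  ultimately show ?thesis by (simp only:)
qed

text \<open>Nothing is known about \<open>a\<close> outside \<open>V\<close>. The open sets
  \<open>V\<close> and \<open>-S\<close> cover the plane, and on \<open>-S\<close> the product is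
  identically zero.\<close>

lemma continuous_on_mult_compact_support:
  fixes a k :: "complex \<Rightarrow> 'b::real_normed_algebra"
  assumes "open V" "continuous_on V a" "continuous_on UNIV k"
    and "compact S" "S \<subseteq> V" "\<And>z. z \<notin> S \<Longrightarrow> k z = 0"
  shows "continuous_on UNIV (\<lambda>z. a z * k z)"
proof -
  have "continuous_on (V \<union> -S) (\<lambda>z. a z * k z)"
  proof (rule continuous_on_open_Un)
    show "continuous_on V (\<lambda>z. a z * k z)"
      using assms(2,3) by (intro continuous_on_mult) (auto intro: continuous_on_subset)
    have "continuous_on (-S) (\<lambda>z. 0::'b)" by simp
    thus "continuous_on (-S) (\<lambda>z. a z * k z)"
      by (rule continuous_on_eq) (use assms(6) in auto)
    show "open (-S)" using assms(4) compact_imp_closed by auto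
  qed (use assms in auto)
  moreover have "V \<union> -S = UNIV" using assms(5) by auto
  ultimately show ?thesis by simp
qed

text \<open>Lets coefficients that are regular only near the support, such as \<open>w\<close>,
  \<open>w_xi\<close> and \<open>\<phi>'\<close>, enter integrations by parts over the whole
  plane.\<close>

lemma C1c_local_mult:
  assumes V: "open V" and a: "\<And>z. z \<in> V \<Longrightarrow> (a has_derivative (\<lambda>h. r z * h + s z * cnj h)) (at z)"
    and c: "continuous_on V r" "continuous_on V s"
    and k: "C1c k p q" and S: "compact S" "S \<subseteq> V" "\<And>z. z \<notin> S \<Longrightarrow> k z = 0"
  shows "C1c (\<lambda>z. a z * k z) (\<lambda>z. r z * k z + a z * p z) (\<lambda>z. s z * k z + a z * q z)"
proof -
  have kd: "(k has_derivative (\<lambda>h. p z * h + q z * cnj h)) (at z)" for z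
    using k unfolding C1c_def by auto
  have pq: "p z = 0 \<and> q z = 0" if "z \<notin> S" for z
    using wirtinger_zero_outside[OF compact_imp_closed[OF S(1)] S(3) that kd] .
  have ca: "continuous_on V a"
    using a has_derivative_continuous continuous_at_imp_continuous_on by blast
  note C = continuous_on_mult_compact_support[OF V _ _ S(1,2)]
  have deriv: "((\<lambda>z. a z * k z) has_derivative (\<lambda>h. (r z * k z + a z * p z) * h + (s z * k z + a z * q z) * cnj h)) (at z)" for z
  proof (cases "z \<in> V")
    case True
    show ?thesis by (rule wirtinger_mult[OF a[OF True] kd])
  next
    case False
    hence z: "z \<notin> S" using S(2) by auto
    have "((\<lambda>z. a z * k z) has_derivative (\<lambda>h. 0)) (at z)"
      by (rule has_derivative_zero_outside[OF compact_imp_closed[OF S(1)] _ z]) (simp add: S(3))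
    thus ?thesis using pq[OF z] S(3)[OF z] by simp
  qed
  have cont: "continuous_on UNIV (\<lambda>z. b z * k z + a z * d z)"
    if "continuous_on V b" "continuous_on UNIV d" "\<And>z. z \<notin> S \<Longrightarrow> d z = 0" for b d
    using C[OF that(1) C1c_continuous[OF k] S(3)] C[OF ca that(2,3)] by (rule continuous_on_add)
  have "continuous_on UNIV p" "continuous_on UNIV q" using k unfolding C1c_def by auto
  hence cont2: "continuous_on UNIV (\<lambda>z. r z * k z + a z * p z)" "continuous_on UNIV (\<lambda>z. s z * k z + a z * q z)"
    using cont[OF c(1), of p] cont[OF c(2), of q] pq by auto
  have supp: "\<exists>S. compact S \<and> (\<forall>z. z \<notin> S \<longrightarrow> a z * k z = 0)"
    using S(1,3) by (intro exI[of _ S]) auto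
  show ?thesis unfolding C1c_def by (intro conjI allI deriv cont2 supp)
qed

lemma C1c_cnj: "C1c F p q \<Longrightarrow> C1c (\<lambda>z. cnj (F z)) (\<lambda>z. cnj (q z)) (\<lambda>z. cnj (p z))"
  unfolding C1c_def by (metis complex_cnj_zero continuous_on_cnj wirtinger_cnj)

lemma C1c_mult:
  assumes "C1c F p q" and "C1c G r s"
  shows "C1c (\<lambda>z. F z * G z) (\<lambda>z. p z * G z + F z * r z) (\<lambda>z. q z * G z + F z * s z)"
proof -
  obtain S where S: "compact S" "\<And>z. z \<notin> S \<Longrightarrow> G z = 0" using C1c_support[OF assms(2)] by metis
  show ?thesis
    by (rule C1c_local_mult[OF open_UNIV _ _ _ assms(2) S(1)])
       (use assms(1) S in \<open>auto simp: C1c_def\<close>)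
qed

lemma C1c_integrable_mult:
  assumes "C1c F p q" "f \<in> {F, p, q}" "continuous_on UNIV g"
  shows "integrable lborel (\<lambda>z. f z * g z)"
proof -
  obtain S where S: "compact S" "\<And>z. z \<notin> S \<Longrightarrow> F z = 0" "\<And>z. z \<notin> S \<Longrightarrow> p z = 0" "\<And>z. z \<notin> S \<Longrightarrow> q z = 0"
    using C1c_support[OF assms(1)] by metis
  show ?thesis
  proof (rule integrable_continuous_compact_support[OF _ S(1)])
    show "continuous_on UNIV (\<lambda>z. f z * g z)"
      using assms C1c_continuous[OF assms(1)] unfolding C1c_def by (auto intro!: continuous_on_mult)
  qed (use assms S in auto)
qed

lemma two_mult_le_sum_squares: "2 * (a * b) \<le> a\<^sup>2 + b\<^sup>2" for a b :: real
  using sum_squares_bound[of a b] by simp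

text \<open>Read \<open>f = \<phi>\<close>, \<open>f1 = \<phi>'\<close>, \<open>n = \<eta>\<close>, \<open>p = \<eta>_xi\<close>, \<open>q = \<eta>_xibar\<close>, \<open>u = w_xi\<close> and
  \<open>t = (w_xi)_xibar\<close>. The argument of the last \<open>Re\<close> and the term \<open>f1 * n * q / 2\<close> have
  integral zero.\<close>

lemma pointwise_estimate:
  fixes f f1 n p q c :: complex and w \<epsilon> :: real
  assumes w: "w > 0" "w\<^sup>2 = (cmod f)\<^sup>2 + \<epsilon>\<^sup>2" and \<epsilon>: "\<epsilon> > 0" and c: "cmod c \<le> 1"
  defines "u \<equiv> f1 * cnj f / (2 * of_real w)"
  defines "t \<equiv> f1 * cnj f1 / (2 * of_real w) - f1 * cnj f * cnj u / (2 * (of_real w)\<^sup>2)"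
  shows "Re (c * (f * p * q + f1 * n * q / 2)) \<le> (w + \<epsilon> / 4) * (cmod q)\<^sup>2
    + Re ((u * n + of_real w * p) * cnj p - (cnj u * n + of_real w * q) * cnj q
        + (t * (n * cnj n) + u * (q * cnj n + n * cnj p))) / 2"
proof -
  define A where "A = p + u / of_real w * n"
  \<comment> \<open>The surplus: \<open>|n|^2 * w\<close> times the mixed second derivative of
    \<open>log w\<close>.\<close>
  define T where "T = \<epsilon>\<^sup>2 * (cmod f1)\<^sup>2 * (cmod n)\<^sup>2 / (2 * w ^ 3)"
  have wle: "cmod f \<le> w" "\<epsilon> \<le> w"
    by (rule power2_le_imp_le; use w in simp)+
  have wc: "complex_of_real w \<noteq> 0" using w by simp
  have W: "(of_real w)\<^sup>2 = f * cnj f + (of_real \<epsilon>)\<^sup>2"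
    using arg_cong[OF w(2), of complex_of_real] by (simp add: complex_norm_square[symmetric])
  \<comment> \<open>By the quotient rule, \<open>t - |u|^2 / w\<close> is \<open>w\<close> times the
    mixed derivative of \<open>log w\<close>. It carries the factor
    \<open>w^2 - |f|^2 = \<epsilon>^2\<close>, in keeping with the harmonicity of
    \<open>log |f|\<close> away from zeros.\<close>
  have t: "t = of_real ((cmod u)\<^sup>2 / w + \<epsilon>\<^sup>2 * (cmod f1)\<^sup>2 / (2 * w ^ 3))"
  proof -
    have "t - of_real ((cmod u)\<^sup>2 / w) = t - u * cnj u / of_real w"
      by (simp only: of_real_divide complex_norm_square)
    also have "\<dots> = f1 * cnj f1 * ((of_real w)\<^sup>2 - f * cnj f) / (2 * (of_real w) ^ 3)"
      using wc by (simp add: t_def u_def divide_simps power3_eq_cube power2_eq_square)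
        (simp add: algebra_simps)
    also have "\<dots> = of_real (\<epsilon>\<^sup>2 * (cmod f1)\<^sup>2 / (2 * w ^ 3))"
      by (simp only: W add_diff_cancel_left' of_real_mult of_real_divide of_real_power complex_norm_square[symmetric] of_real_numeral mult_ac)
    finally show ?thesis by (simp add: algebra_simps)
  qed
  \<comment> \<open>Completing the square: the two copies of \<open>Re (u * n * cnj p)\<close> and
    the part \<open>|u|^2 / w\<close> of \<open>t\<close> combine with \<open>w * |p|^2\<close> to
    \<open>w * |A|^2\<close>, while the cross terms in \<open>q\<close> cancel after taking real
    parts.\<close>
  have id: "Re ((u * n + of_real w * p) * cnj p - (cnj u * n + of_real w * q) * cnj q
        + (t * (n * cnj n) + u * (q * cnj n + n * cnj p))) = w * (cmod A)\<^sup>2 - w * (cmod q)\<^sup>2 + T"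
  proof -
    have 1: "w * (cmod A)\<^sup>2 = w * (cmod p)\<^sup>2 + 2 * Re (u * n * cnj p) + (cmod u)\<^sup>2 / w * (cmod n)\<^sup>2"
    proof -
      have "(cmod (p + x))\<^sup>2 = (cmod p)\<^sup>2 + (cmod x)\<^sup>2 + 2 * Re (x * cnj p)" for x
        unfolding cmod_power2 by (simp add: power2_eq_square algebra_simps)
      hence "(cmod A)\<^sup>2 = (cmod p)\<^sup>2 + (cmod (u / of_real w * n))\<^sup>2 + 2 * Re (u / of_real w * n * cnj p)"
        unfolding A_def .
      also have "(cmod (u / of_real w * n))\<^sup>2 = (cmod (u * n))\<^sup>2 / w\<^sup>2"
        using w(1) by (simp add: norm_mult norm_divide power_mult_distrib power_divide)
      also have "Re (u / of_real w * n * cnj p) = Re (u * n * cnj p) / w"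
        by (metis (no_types, lifting) Re_divide_of_real times_divide_eq_left)
      finally have A2: "(cmod A)\<^sup>2 = (cmod p)\<^sup>2 + (cmod (u * n))\<^sup>2 / w\<^sup>2 + 2 * (Re (u * n * cnj p) / w)" .
      have "w * (a + b / w\<^sup>2 + 2 * (r / w)) = w * a + 2 * r + b / w" for a b r
        using w(1) by (simp add: field_simps power2_eq_square)
      thus ?thesis unfolding A2 by (simp only: norm_mult power_mult_distrib times_divide_eq_left)
    qed
    have 2: "Re (t * (n * cnj n)) = (cmod u)\<^sup>2 / w * (cmod n)\<^sup>2 + T"
    proof -
      have "n * cnj n = of_real ((cmod n)\<^sup>2)" by (rule complex_norm_square[symmetric])
      hence "t * (n * cnj n) = of_real (((cmod u)\<^sup>2 / w + \<epsilon>\<^sup>2 * (cmod f1)\<^sup>2 / (2 * w ^ 3)) * (cmod n)\<^sup>2)"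
        unfolding t by (simp only: of_real_mult)
      thus ?thesis unfolding T_def by (simp add: algebra_simps)
    qed
    have 3: "Re (of_real w * p * cnj p) = w * (cmod p)\<^sup>2" "Re (of_real w * q * cnj q) = w * (cmod q)\<^sup>2"
      unfolding cmod_power2 by (simp_all add: algebra_simps power2_eq_square)
    have "cnj u * n * cnj q = cnj (u * q * cnj n)" by simp
    hence 4: "Re (cnj u * n * cnj q) = Re (u * q * cnj n)" by (simp only: cnj.sel)
    have 5: "(u * n + w * p) * p' - (u' * n + w * q) * q' + (t * (n * n') + u * (q * n' + n * p')) =
        u * n * p' + u * n * p' + w * p * p' - u' * n * q' - w * q * q' + t * (n * n') + u * q * n'"
      for u n w p p' u' q q' t n' :: complex
      by (simp add: ring_distribs)
    show ?thesis unfolding 5 plus_complex.sel minus_complex.sel 1 2 3 4 by linarith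
  qed
  \<comment> \<open>Since \<open>f * cnj f = w^2 - \<epsilon>^2\<close>, the factor
    \<open>f * u / w\<close> falls short of \<open>f1 / 2\<close> by exactly the coefficient of the
    last term.\<close>
  have split: "f * p * q + f1 * n * q / 2 = f * (A * q) + of_real (\<epsilon>\<^sup>2 / (2 * w\<^sup>2)) * (f1 * (n * q))"
  proof -
    have "f * (u / of_real w) = f1 * (f * cnj f) / (2 * (of_real w)\<^sup>2)"
      by (simp add: u_def power2_eq_square mult_ac)
    also have "\<dots> = f1 / 2 - of_real (\<epsilon>\<^sup>2 / (2 * w\<^sup>2)) * f1"
    proof -
      have "f * cnj f = (of_real w)\<^sup>2 - (of_real \<epsilon>)\<^sup>2" by (simp only: W add_diff_cancel_right')
      moreover have "x * (y - e) / (2 * y) = x / 2 - e / (2 * y) * x" if "y \<noteq> 0" for x y e :: complex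
        using that by (simp add: field_simps)
      ultimately show ?thesis using wc by simp
    qed
    finally have e: "f * (u / of_real w) = f1 / 2 - of_real (\<epsilon>\<^sup>2 / (2 * w\<^sup>2)) * f1" .
    have "f * ((p + v * n) * q) = f * p * q + f * v * n * q" for v
      by (simp add: ring_distribs)
    hence "f * (A * q) = f * p * q + f * (u / of_real w) * n * q"
      unfolding A_def .
    thus ?thesis unfolding e by (simp add: ring_distribs)
  qed
  have b1: "Re (c * (f * (A * q))) \<le> w * ((cmod A)\<^sup>2 + (cmod q)\<^sup>2) / 2"
  proof -
    have "Re (c * (f * (A * q))) \<le> cmod c * (cmod f * (cmod A * cmod q))"
      using complex_Re_le_cmod[of "c * (f * (A * q))"] by (simp add: norm_mult)
    also have "\<dots> \<le> 1 * (w * (cmod A * cmod q))"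
      using c wle w(1) by (intro mult_mono) auto
    also have "\<dots> \<le> w * (((cmod A)\<^sup>2 + (cmod q)\<^sup>2) / 2)"
      using w(1) two_mult_le_sum_squares[of "cmod A" "cmod q"] by simp
    finally show ?thesis by simp
  qed
  \<comment> \<open>Arithmetic-geometric mean for \<open>\<epsilon> * |f1| * |n| / w\<close> and
    \<open>\<epsilon> * |q|\<close>, divided by \<open>4 * w\<close>: the first square becomes
    \<open>T / 2\<close>, and the second is at most \<open>\<epsilon> / 4 * |q|^2\<close> because
    \<open>\<epsilon> \<le> w\<close>.\<close>
  have b2: "Re (c * (of_real (\<epsilon>\<^sup>2 / (2 * w\<^sup>2)) * (f1 * (n * q)))) \<le> T / 2 + \<epsilon> / 4 * (cmod q)\<^sup>2"
  proof -
    have "Re (c * (of_real (\<epsilon>\<^sup>2 / (2 * w\<^sup>2)) * (f1 * (n * q)))) \<le> cmod c * (\<epsilon>\<^sup>2 / (2 * w\<^sup>2) * (cmod f1 * (cmod n * cmod q)))"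
      using complex_Re_le_cmod[of "c * (of_real (\<epsilon>\<^sup>2 / (2 * w\<^sup>2)) * (f1 * (n * q)))"]
      by (simp add: norm_mult norm_divide norm_power)
    also have "\<dots> \<le> 1 * (\<epsilon>\<^sup>2 / (2 * w\<^sup>2) * (cmod f1 * (cmod n * cmod q)))"
      using c by (intro mult_right_mono) auto
    also have "\<dots> = 2 * ((\<epsilon> * cmod f1 * cmod n / w) * (\<epsilon> * cmod q)) / (4 * w)"
      using w(1) by (simp add: field_simps power2_eq_square)
    also have "\<dots> \<le> ((\<epsilon> * cmod f1 * cmod n / w)\<^sup>2 + (\<epsilon> * cmod q)\<^sup>2) / (4 * w)"
      using w(1) by (intro divide_right_mono two_mult_le_sum_squares) auto
    also have "\<dots> = T / 2 + \<epsilon> * \<epsilon> / w * (cmod q)\<^sup>2 / 4"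
      using w(1) by (simp add: T_def field_simps power2_eq_square power3_eq_cube)
    also have "\<epsilon> * \<epsilon> / w \<le> \<epsilon>"
      using w(1) \<epsilon> wle by (simp add: field_simps)
    hence "T / 2 + \<epsilon> * \<epsilon> / w * (cmod q)\<^sup>2 / 4 \<le> T / 2 + \<epsilon> * (cmod q)\<^sup>2 / 4"
      by (intro add_left_mono divide_right_mono mult_right_mono) auto
    finally show ?thesis by simp
  qed
  have "Re (c * (f * p * q + f1 * n * q / 2)) = Re (c * (f * (A * q))) + Re (c * (of_real (\<epsilon>\<^sup>2 / (2 * w\<^sup>2)) * (f1 * (n * q))))"
    unfolding split by (simp only: ring_distribs plus_complex.sel)
  also have "\<dots> \<le> w * ((cmod A)\<^sup>2 + (cmod q)\<^sup>2) / 2 + (T / 2 + \<epsilon> / 4 * (cmod q)\<^sup>2)"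
    by (intro add_mono b1 b2)
  also have "\<dots> = (w + \<epsilon> / 4) * (cmod q)\<^sup>2 + (w * (cmod A)\<^sup>2 - w * (cmod q)\<^sup>2 + T) / 2"
    by (simp add: field_simps)
  finally show ?thesis unfolding id .
qed

section \<open>The estimate for holomorphic quadratic differentials\<close>

lemma wirtinger_inverse:
  fixes f :: "complex \<Rightarrow> complex"
  assumes "(f has_derivative (\<lambda>h. p * h + q * cnj h)) (at z)" and "f z \<noteq> 0"
  shows "((\<lambda>z. inverse (f z)) has_derivative (\<lambda>h. - p / (f z)\<^sup>2 * h + - q / (f z)\<^sup>2 * cnj h)) (at z)"
proof -
  have "(\<lambda>h. - (inverse (f z) * (p * h + q * cnj h) * inverse (f z))) =
    (\<lambda>h. - p / (f z)\<^sup>2 * h + - q / (f z)\<^sup>2 * cnj h)"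
    using assms(2) by (simp add: fun_eq_iff field_simps power2_eq_square)
  with Deriv.has_derivative_inverse[OF assms(2,1)] show ?thesis by (simp only:)
qed

text \<open>Turns the modulus of an integral into the real part of a rotated integral, so that a
  pointwise bound on real parts can be integrated.\<close>

lemma exists_unit_multiplier:
  fixes X :: complex
  obtains c where "cmod c \<le> 1" and "c * X = of_real (cmod X)"
proof (cases "X = 0")
  case False
  show thesis
  proof (rule that[of "cnj X / of_real (cmod X)"])
    show "cnj X / of_real (cmod X) * X = of_real (cmod X)"
      using False complex_norm_square[of X]
      by (simp add: divide_simps power2_eq_square mult.commute)
  qed (simp add: norm_divide)
qed (use that[of 0] in auto)

text \<open>Integrating \<open>pointwise_estimate\<close> removes all terms of zero mean. The factor
  \<open>5 / 4\<close> collects one \<epsilon> from \<open>w \<le> |\<phi>| + \<epsilon>\<close> and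
  a quarter from the pointwise error.\<close>

lemma integral_estimate_regularized:
  assumes V: "open V" and \<phi>: "\<phi> holomorphic_on V"
    and \<eta>: "C1c \<eta> p q" and S: "compact S" "S \<subseteq> V" "\<And>z. z \<notin> S \<Longrightarrow> \<eta> z = 0"
    and \<epsilon>: "\<epsilon> > 0"
  shows "cmod (LINT z|lborel. \<phi> z * p z * q z) \<le>
     (LINT z|lborel. cmod (\<phi> z) * (cmod (q z))\<^sup>2) + 5 / 4 * \<epsilon> * (LINT z|lborel. (cmod (q z))\<^sup>2)"
proof -
  define f1 where "f1 = deriv \<phi>"
  define w where "w = (\<lambda>z. sqrt ((cmod (\<phi> z))\<^sup>2 + \<epsilon>\<^sup>2))"
  define u where "u = (\<lambda>z. f1 z * cnj (\<phi> z) / (2 * of_real (w z)))"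
  define t where "t = (\<lambda>z. f1 z * cnj (f1 z) / (2 * of_real (w z)) - f1 z * cnj (\<phi> z) * cnj (u z) / (2 * (of_real (w z))\<^sup>2))"
  \<comment> \<open>The xi derivative of \<open>u\<close>. It enters through its continuity, which
    \<open>C1c\<close> demands of both derivatives of \<open>u * |\<eta>|^2\<close>.\<close>
  define s where "s = (\<lambda>z. deriv f1 z * cnj (\<phi> z) / (2 * of_real (w z)) - f1 z * cnj (\<phi> z) * u z / (2 * (of_real (w z))\<^sup>2))"
  have wpos: "w z > 0" for z using \<epsilon> unfolding w_def by (simp add: add_nonneg_pos)
  have w2: "(w z)\<^sup>2 = (cmod (\<phi> z))\<^sup>2 + \<epsilon>\<^sup>2" for z unfolding w_def by simp
  have wle: "w z \<le> cmod (\<phi> z) + \<epsilon>" for z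
    by (rule power2_le_imp_le) (use w2[of z] \<epsilon> in \<open>auto simp: power2_sum\<close>)
  have hol1: "f1 holomorphic_on V" unfolding f1_def by (rule holomorphic_deriv[OF \<phi> V])
  have d0: "(\<phi> has_field_derivative f1 z) (at z)" if "z \<in> V" for z
    unfolding f1_def by (rule holomorphic_derivI[OF \<phi> V that])
  have d1: "(f1 has_field_derivative deriv f1 z) (at z)" if "z \<in> V" for z
    by (rule holomorphic_derivI[OF hol1 V that])
  have c\<phi>: "continuous_on V \<phi>" "continuous_on V f1" "continuous_on V (deriv f1)"
    using \<phi> hol1 holomorphic_deriv[OF hol1 V] holomorphic_on_imp_continuous_on by auto
  have wne: "complex_of_real (w z) \<noteq> 0" for z using wpos[of z] by simp
  have cw: "continuous_on V w" unfolding w_def by (intro continuous_intros c\<phi>)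
  have cu: "continuous_on V u" unfolding u_def by (intro continuous_intros c\<phi> cw) (use wne in auto)
  have ct: "continuous_on V t" unfolding t_def by (intro continuous_intros c\<phi> cw cu) (use wne in auto)
  have cs: "continuous_on V s" unfolding s_def by (intro continuous_intros c\<phi> cw cu) (use wne in auto)
  have dw: "((\<lambda>z. complex_of_real (w z)) has_derivative (\<lambda>h. u z * h + cnj (u z) * cnj h)) (at z)"
    if "z \<in> V" for z
    unfolding w_def u_def by (rule wirtinger_regularized_norm[OF d0[OF that] \<epsilon>])
  have du: "(u has_derivative (\<lambda>h. s z * h + t z * cnj h)) (at z)" if z: "z \<in> V" for z
  proof -
    have 2: "((\<lambda>z. 2) has_derivative (\<lambda>h. 0 * h + 0 * cnj h)) (at z)" for z :: complex by simp
    have num: "((\<lambda>z. f1 z * cnj (\<phi> z)) has_derivative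
      (\<lambda>h. (deriv f1 z * cnj (\<phi> z)) * h + (f1 z * cnj (f1 z)) * cnj h)) (at z)"
      using wirtinger_mult[OF wirtinger_holomorphic[OF d1[OF z]] wirtinger_cnj[OF wirtinger_holomorphic[OF d0[OF z]]]]
      by simp
    have den: "((\<lambda>z. 2 * complex_of_real (w z)) has_derivative
      (\<lambda>h. (2 * u z) * h + (2 * cnj (u z)) * cnj h)) (at z)"
      using wirtinger_mult[OF 2 dw[OF z]] by simp
    have ne: "2 * complex_of_real (w z) \<noteq> 0" using wne by simp
    note all = wirtinger_mult[OF num wirtinger_inverse[OF den ne]]
    have G: "a / (2 * x) - b * y / (2 * x\<^sup>2) = a * inverse (2 * x) + b * (- (2 * y) / (2 * x)\<^sup>2)"
      if "x \<noteq> 0" for a b x y :: complex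
      using that by (simp add: field_simps power2_eq_square)
    have "u = (\<lambda>z. f1 z * cnj (\<phi> z) * inverse (2 * complex_of_real (w z)))"
      by (simp only: u_def divide_inverse)
    moreover have "s z = deriv f1 z * cnj (\<phi> z) * inverse (2 * complex_of_real (w z)) +
      f1 z * cnj (\<phi> z) * (- (2 * u z) / (2 * complex_of_real (w z))\<^sup>2)"
      unfolding s_def by (rule G[OF wne])
    moreover have "t z = f1 z * cnj (f1 z) * inverse (2 * complex_of_real (w z)) +
      f1 z * cnj (\<phi> z) * (- (2 * cnj (u z)) / (2 * complex_of_real (w z))\<^sup>2)"
      unfolding t_def by (rule G[OF wne])
    ultimately show ?thesis using all by (simp only:)
  qed
  have cq: "continuous_on UNIV p" "continuous_on UNIV q" "continuous_on UNIV \<eta>"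
    using \<eta> C1c_continuous[OF \<eta>] unfolding C1c_def by auto
  have d\<eta>: "(\<eta> has_derivative (\<lambda>h. p z * h + q z * cnj h)) (at z)" for z
    using \<eta> unfolding C1c_def by auto
  have qS: "p z = 0 \<and> q z = 0" if "z \<notin> S" for z
    using wirtinger_zero_outside[OF compact_imp_closed[OF S(1)] S(3) that d\<eta>] .
  have C: "integrable lborel (\<lambda>z. a z * k z)" if "continuous_on V a" "continuous_on UNIV k" "\<And>z. z \<notin> S \<Longrightarrow> k z = 0"
    for a k :: "complex \<Rightarrow> complex"
    using integrable_continuous_compact_support[OF continuous_on_mult_compact_support[OF V that(1,2) S(1,2) that(3)] S(1)]
    by (simp add: that(3))
  have CR: "integrable lborel (\<lambda>z. a z * k z)" if "continuous_on V a" "continuous_on UNIV k" "\<And>z. z \<notin> S \<Longrightarrow> k z = 0"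
    for a k :: "complex \<Rightarrow> real"
    using integrable_continuous_compact_support[OF continuous_on_mult_compact_support[OF V that(1,2) S(1,2) that(3)] S(1)]
    by (simp add: that(3))
  have F1: "C1c (\<lambda>z. complex_of_real (w z) * \<eta> z) (\<lambda>z. u z * \<eta> z + of_real (w z) * p z) (\<lambda>z. cnj (u z) * \<eta> z + of_real (w z) * q z)"
    by (rule C1c_local_mult[OF V _ cu _ \<eta> S]) (use dw cu in \<open>auto intro: continuous_on_cnj\<close>)
  define D1 where "D1 = (\<lambda>z. (u z * \<eta> z + of_real (w z) * p z) * cnj (p z))"
  define D2 where "D2 = (\<lambda>z. (cnj (u z) * \<eta> z + of_real (w z) * q z) * cnj (q z))"
  \<comment> \<open>Conjugation exchanges the two derivatives, so commuting them for
    \<open>w * \<eta>\<close> and \<open>cnj \<eta>\<close> pairs xi with xi in \<open>D1\<close>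
    and xibar with xibar in \<open>D2\<close>.\<close>
  have I1: "(LINT z|lborel. D1 z) = (LINT z|lborel. D2 z)"
    unfolding D1_def D2_def by (rule C1c_integral_commute[OF F1 C1c_cnj[OF \<eta>]])
  have "integrable lborel D1"
    unfolding D1_def by (rule C1c_integrable_mult[OF F1]) (simp, intro continuous_intros cq)
  moreover have "integrable lborel D2"
    unfolding D2_def by (rule C1c_integrable_mult[OF F1]) (simp, intro continuous_intros cq)
  ultimately have I2: "integrable lborel D1" "integrable lborel D2" .
  define D3 where "D3 = (\<lambda>z. t z * (\<eta> z * cnj (\<eta> z)) + u z * (q z * cnj (\<eta> z) + \<eta> z * cnj (p z)))"
  have F3: "C1c (\<lambda>z. u z * (\<eta> z * cnj (\<eta> z))) (\<lambda>z. s z * (\<eta> z * cnj (\<eta> z)) + u z * (p z * cnj (\<eta> z) + \<eta> z * cnj (q z))) D3"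
    unfolding D3_def
    by (rule C1c_local_mult[OF V du cs ct C1c_mult[OF \<eta> C1c_cnj[OF \<eta>]] S(1,2)]) (use S(3) in auto)
  have I3: "(LINT z|lborel. D3 z) = 0" "integrable lborel D3"
    using C1c_integral_deriv_eq_0[OF F3] C1c_integrable[OF F3] by auto
  \<comment> \<open>As \<open>f1\<close> is holomorphic, the xibar derivative of
    \<open>f1 * \<eta>^2\<close> is \<open>2 * f1 * \<eta> * q\<close>, four times the correction
    term.\<close>
  have F4: "C1c (\<lambda>z. f1 z * (\<eta> z * \<eta> z)) (\<lambda>z. deriv f1 z * (\<eta> z * \<eta> z) + f1 z * (p z * \<eta> z + \<eta> z * p z))
      (\<lambda>z. 0 * (\<eta> z * \<eta> z) + f1 z * (q z * \<eta> z + \<eta> z * q z))"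
    by (rule C1c_local_mult[OF V wirtinger_holomorphic[OF d1] c\<phi>(3) _ C1c_mult[OF \<eta> \<eta>] S(1,2)]) (use S(3) in auto)
  have E4: "(\<lambda>z. f1 z * \<eta> z * q z / 2) = (\<lambda>z. (0 * (\<eta> z * \<eta> z) + f1 z * (q z * \<eta> z + \<eta> z * q z)) / 4)"
    by (simp add: fun_eq_iff algebra_simps)
  have I4: "(LINT z|lborel. f1 z * \<eta> z * q z / 2) = 0" "integrable lborel (\<lambda>z. f1 z * \<eta> z * q z / 2)"
    unfolding E4
    by (simp only: integral_divide_zero C1c_integral_deriv_eq_0(2)[OF F4] div_0, intro integrable_divide C1c_integrable(3)[OF F4])
  have I5: "integrable lborel (\<lambda>z. \<phi> z * p z * q z)"
    unfolding mult.assoc by (rule C[OF c\<phi>(1) continuous_on_mult[OF cq(1,2)]]) (simp add: qS)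
  have cq2: "continuous_on UNIV (\<lambda>z. (cmod (q z))\<^sup>2)" by (intro continuous_intros cq)
  have I6: "integrable lborel (\<lambda>z. cmod (\<phi> z) * (cmod (q z))\<^sup>2)"
    by (rule CR[OF continuous_on_norm[OF c\<phi>(1)] cq2]) (simp add: qS)
  have I7: "integrable lborel (\<lambda>z. (cmod (q z))\<^sup>2)"
    using CR[OF continuous_on_const cq2, of 1] qS by simp
  obtain c where c: "cmod c \<le> 1" and cX: "c * (LINT z|lborel. \<phi> z * p z * q z) = of_real (cmod (LINT z|lborel. \<phi> z * p z * q z))"
    by (rule exists_unit_multiplier)
  have "cmod (LINT z|lborel. \<phi> z * p z * q z) = Re (c * ((LINT z|lborel. \<phi> z * p z * q z) + (LINT z|lborel. f1 z * \<eta> z * q z / 2)))"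
    unfolding I4 using cX by simp
  also have "\<dots> = Re (LINT z|lborel. c * (\<phi> z * p z * q z + f1 z * \<eta> z * q z / 2))"
    by (simp only: integral_mult_right_zero Bochner_Integration.integral_add[OF I5 I4(2)])
  also have "\<dots> = (LINT z|lborel. Re (c * (\<phi> z * p z * q z + f1 z * \<eta> z * q z / 2)))"
    by (rule integral_Re[symmetric]) (intro integrable_mult_right Bochner_Integration.integrable_add I5 I4)
  also have "\<dots> \<le> (LINT z|lborel. (cmod (\<phi> z) * (cmod (q z))\<^sup>2 + 5 / 4 * \<epsilon> * (cmod (q z))\<^sup>2) + Re (D1 z - D2 z + D3 z) / 2)"
  proof (rule integral_mono)
    show "integrable lborel (\<lambda>z. Re (c * (\<phi> z * p z * q z + f1 z * \<eta> z * q z / 2)))"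
      by (intro integrable_Re integrable_mult_right Bochner_Integration.integrable_add I5 I4)
    show "integrable lborel (\<lambda>z. (cmod (\<phi> z) * (cmod (q z))\<^sup>2 + 5 / 4 * \<epsilon> * (cmod (q z))\<^sup>2) + Re (D1 z - D2 z + D3 z) / 2)"
      by (intro integrable_Re integrable_mult_right Bochner_Integration.integrable_add Bochner_Integration.integrable_diff
         integrable_divide I6 I7 I2 I3)
    fix z
    have "Re (c * (\<phi> z * p z * q z + f1 z * \<eta> z * q z / 2)) \<le> (w z + \<epsilon> / 4) * (cmod (q z))\<^sup>2 + Re (D1 z - D2 z + D3 z) / 2"
      using pointwise_estimate[OF wpos w2 \<epsilon> c] unfolding D1_def D2_def D3_def u_def t_def .
    also have "(w z + \<epsilon> / 4) * (cmod (q z))\<^sup>2 \<le> (cmod (\<phi> z) + \<epsilon> + \<epsilon> / 4) * (cmod (q z))\<^sup>2"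
      using wle[of z] by (intro mult_right_mono) auto
    also have "\<dots> = cmod (\<phi> z) * (cmod (q z))\<^sup>2 + 5 / 4 * \<epsilon> * (cmod (q z))\<^sup>2"
      by (simp add: algebra_simps)
    finally show "Re (c * (\<phi> z * p z * q z + f1 z * \<eta> z * q z / 2)) \<le>
       (cmod (\<phi> z) * (cmod (q z))\<^sup>2 + 5 / 4 * \<epsilon> * (cmod (q z))\<^sup>2) + Re (D1 z - D2 z + D3 z) / 2" by simp
  qed
  also have "\<dots> = (LINT z|lborel. cmod (\<phi> z) * (cmod (q z))\<^sup>2) + 5 / 4 * \<epsilon> * (LINT z|lborel. (cmod (q z))\<^sup>2)"
  proof -
    have "(LINT z|lborel. Re (D1 z - D2 z + D3 z)) = Re (LINT z|lborel. D1 z - D2 z + D3 z)"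
      by (rule integral_Re) (intro Bochner_Integration.integrable_add Bochner_Integration.integrable_diff I2 I3)
    also have "\<dots> = 0" using I1 I2 I3 by simp
    finally have 0: "(LINT z|lborel. Re (D1 z - D2 z + D3 z) / 2) = 0" by simp
    have R: "integrable lborel (\<lambda>z. Re (D1 z - D2 z + D3 z) / 2)"
      by (intro integrable_Re Bochner_Integration.integrable_add Bochner_Integration.integrable_diff integrable_divide I2 I3)
    have A: "integrable lborel (\<lambda>z. 5 / 4 * \<epsilon> * (cmod (q z))\<^sup>2)"
      by (intro integrable_mult_right I7)
    show ?thesis
      by (simp only: Bochner_Integration.integral_add[OF Bochner_Integration.integrable_add[OF I6 A] R] 0
         Bochner_Integration.integral_add[OF I6 A] integral_mult_right_zero add_0_right)
  qed
  finally show ?thesis .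
qed

lemma integral_estimate_holomorphic:
  assumes V: "open V" and \<phi>: "\<phi> holomorphic_on V"
    and \<eta>: "C1c \<eta> p q" and S: "compact S" "S \<subseteq> V" "\<And>z. z \<notin> S \<Longrightarrow> \<eta> z = 0"
  shows "cmod (LINT z|lborel. \<phi> z * p z * q z) \<le> (LINT z|lborel. cmod (\<phi> z) * (cmod (q z))\<^sup>2)"
proof (rule field_le_epsilon)
  fix e :: real assume e: "e > 0"
  define K where "K = (LINT z|lborel. (cmod (q z))\<^sup>2)"
  have K: "K \<ge> 0" unfolding K_def by (rule Bochner_Integration.integral_nonneg) simp
  \<comment> \<open>The summand 1 keeps the denominator positive when \<open>K = 0\<close>.\<close>
  define \<epsilon> where "\<epsilon> = e / (5 / 4 * K + 1)"
  have \<epsilon>: "\<epsilon> > 0" using e K unfolding \<epsilon>_def by simp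
  have "5 / 4 * \<epsilon> * K \<le> \<epsilon> * (5 / 4 * K + 1)" using \<epsilon> by (simp add: algebra_simps)
  also have "\<dots> = e" using K unfolding \<epsilon>_def by simp
  finally have "5 / 4 * \<epsilon> * K \<le> e" .
  thus "cmod (LINT z|lborel. \<phi> z * p z * q z) \<le> (LINT z|lborel. cmod (\<phi> z) * (cmod (q z))\<^sup>2) + e"
    using integral_estimate_regularized[OF assms \<epsilon>] unfolding K_def by linarith
qed

section \<open>Smooth bump functions\<close>

lemma dir_deriv_eq: "(f has_derivative f') (at z) \<Longrightarrow> dir_deriv v f z = f' v"
  using frechet_derivative_at[of f f' z] by (simp add: dir_deriv_def)

lemma C_k_imp_continuous: "C_k k f \<Longrightarrow> continuous_on UNIV f"
  by (cases k) (auto simp: continuous_on_eq_continuous_at intro: differentiable_imp_continuous_within)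

lemma C_k_Suc_imp: "C_k (Suc k) f \<Longrightarrow> C_k k f"
proof (induction k arbitrary: f)
  case 0
  thus ?case using C_k_imp_continuous by (metis C_k.simps(1))
next
  case (Suc k)
  thus ?case by (simp only: C_k.simps(2)[of "Suc k"] C_k.simps(2)[of k f]) blast
qed

lemma C_k_add: "C_k k f \<Longrightarrow> C_k k g \<Longrightarrow> C_k k (\<lambda>z. f z + g z)"
proof (induction k arbitrary: f g)
  case (Suc k)
  have df: "f differentiable (at z)" and dg: "g differentiable (at z)" for z
    using Suc.prems by auto
  have d: "dir_deriv v (\<lambda>z. f z + g z) = (\<lambda>z. dir_deriv v f z + dir_deriv v g z)" for v
  proof
    fix z
    have "(f has_derivative frechet_derivative f (at z)) (at z)" "(g has_derivative frechet_derivative g (at z)) (at z)"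
      using df dg frechet_derivative_works by blast+
    from dir_deriv_eq[OF has_derivative_add[OF this]]
    show "dir_deriv v (\<lambda>z. f z + g z) z = dir_deriv v f z + dir_deriv v g z"
      by (simp add: dir_deriv_def)
  qed
  show ?case using Suc by (auto simp: d)
qed (simp add: continuous_on_add)

text \<open>The product rule leaves one factor undifferentiated; \<open>C_k_Suc_imp\<close> lowers
  its order to fit the induction hypothesis.\<close>

lemma C_k_mult: "C_k k f \<Longrightarrow> C_k k g \<Longrightarrow> C_k k (\<lambda>z. f z * g z)"
proof (induction k arbitrary: f g)
  case (Suc k)
  have df: "f differentiable (at z)" and dg: "g differentiable (at z)" for z
    using Suc.prems by auto
  have d: "dir_deriv v (\<lambda>z. f z * g z) = (\<lambda>z. f z * dir_deriv v g z + dir_deriv v f z * g z)" for v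
  proof
    fix z
    have "(f has_derivative frechet_derivative f (at z)) (at z)" "(g has_derivative frechet_derivative g (at z)) (at z)"
      using df dg frechet_derivative_works by blast+
    from dir_deriv_eq[OF has_derivative_mult[OF this]]
    show "dir_deriv v (\<lambda>z. f z * g z) z = f z * dir_deriv v g z + dir_deriv v f z * g z"
      by (simp add: dir_deriv_def)
  qed
  have "C_k k (\<lambda>z. f z * dir_deriv v g z + dir_deriv v f z * g z)" if "v = 1 \<or> v = \<i>" for v
    using Suc.prems that by (intro C_k_add Suc.IH) (auto intro: C_k_Suc_imp)
  moreover have "(\<lambda>z. f z * g z) differentiable (at z)" for z
    using df dg by (intro differentiable_mult)
  ultimately show ?case by (auto simp: d)
qed (simp add: continuous_on_mult)

lemma C_k_const: "C_k k (\<lambda>z. c)"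
proof (induction k arbitrary: c)
  case (Suc k)
  have "dir_deriv v (\<lambda>z. c) = (\<lambda>z. 0)" for v
    by (simp add: dir_deriv_def fun_eq_iff)
  thus ?case using Suc by simp
qed simp

lemma C_k_bounded_linear:
  assumes "bounded_linear f"
  shows "C_k k f"
proof (cases k)
  case 0
  thus ?thesis using assms linear_continuous_on by auto
next
  case (Suc m)
  have "(f has_derivative f) (at z)" for z by (rule bounded_linear.has_derivative[OF assms]) simp
  hence "dir_deriv v f = (\<lambda>z. f v)" "f differentiable (at z)" for v z
    by (auto simp: fun_eq_iff dir_deriv_eq differentiable_def)
  thus ?thesis using Suc C_k_const by simp
qed

text \<open>A polynomial in \<open>1 / t\<close> in front of the standard flat function makes the
  family closed under differentiation, so smoothness is a single induction with \<open>p\<close>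
  arbitrary.\<close>

definition flat_exp :: "real poly \<Rightarrow> real \<Rightarrow> real" where
  "flat_exp p t = (if t > 0 then poly p (1 / t) * exp (- (1 / t)) else 0)"

text \<open>With \<open>x = 1 / t\<close>, the derivative of \<open>p(x) exp(-x)\<close> in
  \<open>t\<close> is \<open>x^2 (p - p')(x) exp(-x)\<close>.\<close>

definition flat_exp_deriv :: "real poly \<Rightarrow> real poly" where
  "flat_exp_deriv p = [:0, 0, 1:] * (p - pderiv p)"

lemma poly_mult_exp_minus_tendsto_0: "((\<lambda>x::real. poly p x * exp (- x)) \<longlongrightarrow> 0) at_top"
proof -
  have "((\<lambda>x::real. \<Sum>i\<le>degree p. coeff p i * (x ^ i / exp x)) \<longlongrightarrow> (\<Sum>i\<le>degree p. coeff p i * 0)) at_top"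
    by (intro tendsto_intros tendsto_power_div_exp_0)
  moreover have "(\<lambda>x::real. \<Sum>i\<le>degree p. coeff p i * (x ^ i / exp x)) = (\<lambda>x. poly p x * exp (- x))"
    by (simp add: fun_eq_iff poly_altdef sum_distrib_right exp_minus divide_inverse mult.assoc)
  ultimately show ?thesis by simp
qed

text \<open>At 0 the right difference quotient is \<open>x * poly p x * exp (- x)\<close> with
  \<open>x = 1 / h\<close>, and the exponential beats every polynomial.\<close>

lemma flat_exp_has_derivative: "(flat_exp p has_real_derivative flat_exp (flat_exp_deriv p) t) (at t)"
proof (cases t "0::real" rule: linorder_cases)
  case less
  have "((\<lambda>t. 0) has_real_derivative 0) (at t)" by simp
  hence "(flat_exp p has_real_derivative 0) (at t)"
    by (rule has_field_derivative_transform_within_open[of _ _ _ "{..<0}"]) (use less in \<open>auto simp: flat_exp_def\<close>)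
  thus ?thesis using less by (simp add: flat_exp_def)
next
  case greater
  have "((\<lambda>t. poly p (1 / t) * exp (- (1 / t))) has_real_derivative flat_exp (flat_exp_deriv p) t) (at t)"
    using greater by (auto intro!: derivative_eq_intros simp: flat_exp_def flat_exp_deriv_def field_simps power2_eq_square)
  thus ?thesis
    by (rule has_field_derivative_transform_within_open[of _ _ _ "{0<..}"]) (use greater in \<open>auto simp: flat_exp_def\<close>)
next
  case equal
  have "((\<lambda>h. flat_exp p h / h) \<longlongrightarrow> 0) (at 0)"
  proof (rule filterlim_split_at_real)
    show "((\<lambda>h. flat_exp p h / h) \<longlongrightarrow> 0) (at_left 0)"
      by (rule tendsto_eventually) (auto simp: eventually_at_filter flat_exp_def)
    have "((\<lambda>h::real. poly ([:0, 1:] * p) (inverse h) * exp (- inverse h)) \<longlongrightarrow> 0) (at_right 0)"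
      by (rule filterlim_compose[OF poly_mult_exp_minus_tendsto_0 filterlim_inverse_at_top_right])
    moreover have "\<forall>\<^sub>F h in at_right 0. poly ([:0, 1:] * p) (inverse h) * exp (- inverse h) = flat_exp p h / h"
      by (auto simp: eventually_at_filter flat_exp_def divide_inverse)
    ultimately show "((\<lambda>h. flat_exp p h / h) \<longlongrightarrow> 0) (at_right 0)"
      by (rule Lim_transform_eventually)
  qed
  thus ?thesis using equal by (simp add: DERIV_def flat_exp_def)
qed

text \<open>The squared distance, unlike the distance, is smooth at the centre. General
  \<open>p\<close> is needed because derivatives of bumps are bumps with other polynomials, times
  affine factors.\<close>

definition bump :: "real poly \<Rightarrow> complex \<Rightarrow> real \<Rightarrow> complex \<Rightarrow> complex" where
  "bump p c d z = of_real (flat_exp p (d\<^sup>2 - (cmod (z - c))\<^sup>2))"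

lemma bump_has_derivative:
  "(bump p c d has_derivative (\<lambda>h. bump (flat_exp_deriv p) c d z * of_real (-2 * ((z - c) \<bullet> h)))) (at z)"
proof -
  have "((\<lambda>z. d\<^sup>2 - (z - c) \<bullet> (z - c)) has_derivative (\<lambda>h. -2 * ((z - c) \<bullet> h))) (at z)"
    by (auto intro!: derivative_eq_intros simp: inner_commute)
  hence "((\<lambda>z. d\<^sup>2 - (cmod (z - c))\<^sup>2) has_derivative (\<lambda>h. -2 * ((z - c) \<bullet> h))) (at z)"
    by (simp add: power2_norm_eq_inner)
  from bounded_linear.has_derivative[OF bounded_linear_of_real
      DERIV_compose_FDERIV[where f="flat_exp p" and g="\<lambda>z. d\<^sup>2 - (cmod (z - c))\<^sup>2", OF flat_exp_has_derivative this]]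
  show ?thesis by (simp add: bump_def[abs_def] mult.commute)
qed

lemma C_k_bump: "C_k k (bump p c d)"
proof (induction k arbitrary: p)
  case 0
  show ?case using has_derivative_continuous[OF bump_has_derivative]
    by (simp add: continuous_on_eq_continuous_at)
next
  case (Suc k)
  \<comment> \<open>The affine factor is split into a linear and a constant part to match the
    closure rules for \<open>C_k\<close>.\<close>
  have d: "dir_deriv v (bump p c d) = (\<lambda>z. bump (flat_exp_deriv p) c d z * (of_real ((-2 * v) \<bullet> z) + of_real (2 * (c \<bullet> v))))" for v
  proof
    fix z
    have "-2 * ((z - c) \<bullet> v) = (-2 * v) \<bullet> z + 2 * (c \<bullet> v)"
      by (simp add: inner_complex_def algebra_simps)
    thus "dir_deriv v (bump p c d) z = bump (flat_exp_deriv p) c d z * (of_real ((-2 * v) \<bullet> z) + of_real (2 * (c \<bullet> v)))"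
      unfolding dir_deriv_eq[OF bump_has_derivative] by (simp only: of_real_add)
  qed
  have "bounded_linear (\<lambda>z. complex_of_real ((-2 * v) \<bullet> z))" for v
    by (rule bounded_linear_compose[OF bounded_linear_of_real bounded_linear_inner_right])
  hence "C_k k (dir_deriv v (bump p c d))" for v
    unfolding d by (intro C_k_mult Suc.IH C_k_add C_k_bounded_linear C_k_const)
  moreover have "bump p c d differentiable (at z)" for z
    using bump_has_derivative unfolding differentiable_def by blast
  ultimately show ?case by simp
qed

lemma bump_eq_0:
  assumes "d \<ge> 0" "z \<notin> cball c d"
  shows "bump p c d z = 0"
proof -
  have "d < cmod (z - c)" using assms(2) by (simp add: dist_norm norm_minus_commute)
  hence "d\<^sup>2 < (cmod (z - c))\<^sup>2" using assms(1) by (simp add: power_strict_mono)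
  thus ?thesis by (simp add: bump_def flat_exp_def)
qed

lemma bump_test_function:
  assumes "d \<ge> 0" and "cball c d \<subseteq> U"
  shows "bump p c d \<in> test_functions U"
proof -
  have sub: "closure {z. bump p c d z \<noteq> 0} \<subseteq> cball c d"
    using bump_eq_0[OF assms(1), of _ c p] by (intro closure_minimal) blast+
  hence "compact (closure {z. bump p c d z \<noteq> 0})"
    by (meson bounded_cball bounded_subset closed_closure compact_eq_bounded_closed)
  thus ?thesis using sub assms(2) C_k_bump unfolding test_functions_def by auto
qed

lemma bump_translate: "bump p c d z = bump p 0 d (z - c)"
  by (simp add: bump_def)

section \<open>Continuity of translations in the mean\<close>

text \<open>If exactly one of \<open>z\<close> and \<open>z + y\<close> lies in \<open>A\<close>,
  that point is in \<open>U\<close>. Either it misses \<open>K\<close>, or it lies in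
  \<open>K\<close>, and then the other point is in \<open>U\<close> but not in
  \<open>K\<close>.\<close>

lemma indicator_translate_bound:
  assumes "K \<subseteq> A" "A \<subseteq> U" and K: "\<And>x. x \<in> K \<Longrightarrow> cball x d \<subseteq> U" and y: "norm y \<le> d"
  shows "\<bar>indicator A (z + y) - indicator A z\<bar> \<le>
    (indicator U z - indicator K z) + (indicator U (z + y) - indicator K (z + y) :: real)"
proof -
  have "z + y \<in> U" if "z \<in> K" using K[OF that] y by (auto simp: dist_norm)
  moreover have "z \<in> U" if "z + y \<in> K" using K[OF that] y by (auto simp: dist_norm)
  ultimately show ?thesis using assms(1,2) by (auto simp: indicator_def)
qed

lemma compact_open_approximation:
  fixes A :: "'a::euclidean_space set"
  assumes A: "A \<in> sets borel" "emeasure lborel A < \<infinity>" and "e > 0"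
  obtains K U where "compact K" "open U" "K \<subseteq> A" "A \<subseteq> U" "emeasure lborel U < \<infinity>"
    "measure lborel U - measure lborel K < e"
proof -
  note [measurable] = A(1)
  obtain U where U: "open U" "A \<subseteq> U" "emeasure lborel (U - A) < ennreal (e / 2)"
    using outer_regular_lborel[OF A(1), of "e / 2"] \<open>e > 0\<close> by auto
  have [measurable]: "U \<in> sets borel" using U(1) by simp
  have "emeasure lborel U = emeasure lborel (U - A) + emeasure lborel A"
    using U(2) by (subst plus_emeasure) (auto simp: Un_absorb2)
  moreover have UAfin: "emeasure lborel (U - A) < \<infinity>" using U(3) by (metis ennreal_less_top infinity_ennreal_def order.strict_trans)
  ultimately have Ufin: "emeasure lborel U < \<infinity>" using A(2) by (simp add: ennreal_add_less_top)
  have mU: "measure lborel U < measure lborel A + e / 2"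
  proof -
    have "measure lborel (U - A) = measure lborel U - measure lborel A"
      using A U(2) Ufin by (intro measure_Diff) auto
    moreover have "measure lborel (U - A) < e / 2"
      using U(3) UAfin \<open>e > 0\<close> emeasure_eq_ennreal_measure[of lborel "U - A"]
      by (simp add: less_top ennreal_less_iff)
    ultimately show ?thesis by simp
  qed
  \<comment> \<open>Lebesgue measure restricted to \<open>A\<close> is finite, as
    \<open>inner_regular\<close> requires.\<close>
  define M where "M = density lborel (indicator A)"
  have M: "emeasure M B = emeasure lborel (A \<inter> B)" if "B \<in> sets borel" for B
    unfolding M_def using that by (simp add: emeasure_density nn_integral_indicator indicator_inter_arith[symmetric] Int_commute)
  have "emeasure M A = (SUP K \<in> {K. K \<subseteq> A \<and> compact K}. emeasure M K)"
  proof (rule inner_regular)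
    show "emeasure M (space M) \<noteq> \<infinity>"
      using M[of UNIV] A(2) by (simp add: M_def)
  qed (auto simp: M_def A(1))
  moreover have "emeasure M A = ennreal (measure lborel A)"
    using M[OF A(1)] A(2) by (simp add: emeasure_eq_ennreal_measure less_top)
  ultimately have sup: "ennreal (measure lborel A) = (SUP K \<in> {K. K \<subseteq> A \<and> compact K}. emeasure M K)" by simp
  have "\<exists>K. K \<subseteq> A \<and> compact K \<and> measure lborel A - e / 2 < measure lborel K"
  \<comment> \<open>\<open>ennreal\<close> truncates negative numbers to 0, which could destroy the
    strict inequality below; here the empty set is already good enough.\<close>
  proof (cases "measure lborel A - e / 2 < 0")
    case True
    thus ?thesis by (intro exI[of _ "{}"]) auto
  next
    case False
    hence "ennreal (measure lborel A - e / 2) < ennreal (measure lborel A)"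
      using \<open>e > 0\<close> by (intro ennreal_lessI) auto
    hence "ennreal (measure lborel A - e / 2) < (SUP K \<in> {K. K \<subseteq> A \<and> compact K}. emeasure M K)"
      unfolding sup .
    then obtain K where K: "K \<subseteq> A" "compact K" "ennreal (measure lborel A - e / 2) < emeasure M K"
      unfolding less_SUP_iff by auto
    have "emeasure M K = emeasure lborel K"
      using M[of K] K(1,2) by (simp add: Int_absorb1 compact_imp_closed)
    also have "\<dots> = ennreal (measure lborel K)"
      using emeasure_compact_finite[OF K(2)] by (intro emeasure_eq_ennreal_measure) (simp add: less_top)
    finally have "measure lborel A - e / 2 < measure lborel K"
      using K(3) False by (simp add: ennreal_less_iff)
    thus ?thesis using K by blast
  qed
  then obtain K where "K \<subseteq> A" "compact K" "measure lborel A - e / 2 < measure lborel K" by blast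
  with U Ufin mU that[of K U] show thesis by simp
qed

text \<open>Induction on integrable functions. A translated indicator changes only within the thin
  set \<open>U - K\<close> and its translate; for limits, translation invariance makes the shifted
  approximation error equal to the unshifted one.\<close>

lemma L1_translation_continuous:
  fixes g :: "'a::euclidean_space \<Rightarrow> 'b::{banach, second_countable_topology}"
  assumes "integrable lborel g"
  shows "\<forall>e>0. \<exists>d>0. \<forall>y. norm y < d \<longrightarrow> (LINT z|lborel. norm (g (z + y) - g z)) < e"
  using assms
proof induction
  case (base A c)
  show ?case
  proof (intro allI impI)
    fix e :: real assume e: "e > 0"
    \<comment> \<open>The factor 2 counts \<open>D\<close> at \<open>z\<close> and at
      \<open>z + y\<close>; the summand 1 covers \<open>c = 0\<close>.\<close>
    define e' where "e' = e / (2 * (norm c + 1))"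
    have e': "e' > 0" unfolding e'_def using e by (intro divide_pos_pos mult_pos_pos) (auto intro: add_nonneg_pos)
    obtain K U where KU: "compact K" "open U" "K \<subseteq> A" "A \<subseteq> U" "emeasure lborel U < \<infinity>"
      and m: "measure lborel U - measure lborel K < e'"
      using compact_open_approximation[OF _ base(2) e'] base(1) by auto
    have [measurable]: "A \<in> sets borel" "U \<in> sets borel" "K \<in> sets borel"
      using base(1) KU(2) borel_closed[OF compact_imp_closed[OF KU(1)]] by simp_all
    have "K \<subseteq> U" using KU by auto
    then obtain d where d: "d > 0" "(\<Union>x\<in>K. cball x d) \<subseteq> U"
      using compact_subset_open_imp_cball_epsilon_subset[OF KU(1,2)] by metis
    have iU: "integrable lborel (indicator U :: 'a \<Rightarrow> real)" "integrable lborel (indicator K :: 'a \<Rightarrow> real)"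
      using KU(5) emeasure_compact_finite[OF KU(1)] by (auto intro!: integrable_real_indicator simp: less_top)
    define D where "D = (\<lambda>z. indicator U z - indicator K z :: real)"
    have D: "integrable lborel D" "(LINT z|lborel. D z) = measure lborel U - measure lborel K"
      unfolding D_def using iU by auto
    have "(LINT z|lborel. norm (indicator A (z + y) *\<^sub>R c - indicator A z *\<^sub>R c)) < e" if y: "norm y < d" for y
    proof -
      have "(LINT z|lborel. norm (indicator A (z + y) *\<^sub>R c - indicator A z *\<^sub>R c)) \<le> (LINT z|lborel. norm c * (D z + D (z + y)))"
      proof (rule integral_mono_AE')
        show "integrable lborel (\<lambda>z. norm c * (D z + D (z + y)))"
          using D(1) integrable_translate[OF D(1), of y] by (intro integrable_mult_right Bochner_Integration.integrable_add)
        show "AE z in lborel. norm (indicator A (z + y) *\<^sub>R c - indicator A z *\<^sub>R c) \<le> norm c * (D z + D (z + y))"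
        proof (rule AE_I2)
          fix z
          have "\<bar>indicator A (z + y) - indicator A z :: real\<bar> \<le> D z + D (z + y)"
            unfolding D_def using indicator_translate_bound[OF KU(3,4), of d y z] d(2) y by force
          hence "norm c * \<bar>indicator A (z + y) - indicator A z :: real\<bar> \<le> norm c * (D z + D (z + y))"
            by (intro mult_left_mono) auto
          thus "norm (indicator A (z + y) *\<^sub>R c - indicator A z *\<^sub>R c) \<le> norm c * (D z + D (z + y))"
            by (simp only: scaleR_diff_left[symmetric] norm_scaleR real_norm_def mult.commute)
        qed
        show "AE z in lborel. 0 \<le> norm c * (D z + D (z + y))"
          using \<open>K \<subseteq> U\<close> by (intro AE_I2 mult_nonneg_nonneg add_nonneg_nonneg) (auto simp: D_def indicator_def)
      qed
      also have "\<dots> = norm c * (2 * (measure lborel U - measure lborel K))"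
        using D integrable_translate[OF D(1), of y] integral_translate[of D y] borel_measurable_integrable[OF D(1)]
        by simp
      also have "\<dots> \<le> norm c * (2 * e')" using m by (intro mult_left_mono) auto
      also have "\<dots> = e * (norm c / (norm c + 1))" unfolding e'_def by (simp add: divide_simps)
      also have "\<dots> < e * 1" using e by (intro mult_strict_left_mono) (auto simp: divide_simps add_nonneg_pos)
      finally show ?thesis by simp
    qed
    thus "\<exists>d>0. \<forall>y. norm y < d \<longrightarrow> (LINT z|lborel. norm (indicator A (z + y) *\<^sub>R c - indicator A z *\<^sub>R c)) < e"
      using d(1) by blast
  qed
next
  case (add f g)
  show ?case
  proof (intro allI impI)
    fix e :: real assume "e > 0"
    hence e: "e / 2 > 0" by simp
    obtain d1 where d1: "d1 > 0" "\<And>y. norm y < d1 \<Longrightarrow> (LINT z|lborel. norm (f (z + y) - f z)) < e / 2"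
      using add.IH(1) e by blast
    obtain d2 where d2: "d2 > 0" "\<And>y. norm y < d2 \<Longrightarrow> (LINT z|lborel. norm (g (z + y) - g z)) < e / 2"
      using add.IH(2) e by blast
    have "(LINT z|lborel. norm (f (z + y) + g (z + y) - (f z + g z))) < e" if "norm y < min d1 d2" for y
    proof -
      have I: "integrable lborel (\<lambda>z. norm (f (z + y) - f z))" "integrable lborel (\<lambda>z. norm (g (z + y) - g z))"
        using add.hyps integrable_translate by (auto intro!: integrable_norm Bochner_Integration.integrable_diff)
      have "(LINT z|lborel. norm (f (z + y) + g (z + y) - (f z + g z))) \<le>
          (LINT z|lborel. norm (f (z + y) - f z) + norm (g (z + y) - g z))"
        by (rule integral_mono_AE') (use I in \<open>auto intro!: Bochner_Integration.integrable_add simp: norm_diff_triangle_ineq\<close>)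
      also have "\<dots> = (LINT z|lborel. norm (f (z + y) - f z)) + (LINT z|lborel. norm (g (z + y) - g z))"
        using I by (rule Bochner_Integration.integral_add)
      also have "\<dots> < e" using d1(2)[of y] d2(2)[of y] that by auto
      finally show ?thesis .
    qed
    thus "\<exists>d>0. \<forall>y. norm y < d \<longrightarrow> (LINT z|lborel. norm (f (z + y) + g (z + y) - (f z + g z))) < e"
      using d1(1) d2(1) by (intro exI[of _ "min d1 d2"]) auto
  qed
next
  case (lim f s)
  show ?case
  proof (intro allI impI)
    fix e :: real assume "e > 0"
    hence e: "e / 3 > 0" by simp
    note [measurable] = borel_measurable_integrable[OF lim.hyps(1)] borel_measurable_integrable[OF \<open>integrable lborel f\<close>]
    have "(\<lambda>i. LINT z|lborel. norm (s i z - f z)) \<longlonglongrightarrow> (LINT z::'a|lborel. (0::real))"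
    proof (rule integral_dominated_convergence)
      show "integrable lborel (\<lambda>z. 3 * norm (f z))" using lim by auto
      show "AE z in lborel. (\<lambda>i. norm (s i z - f z)) \<longlonglongrightarrow> 0"
        using lim.hyps(2) by (intro AE_I2 tendsto_norm_zero) (auto simp: LIM_zero_iff)
      show "AE z in lborel. norm (norm (s i z - f z)) \<le> 3 * norm (f z)" for i
      proof (rule AE_I2)
        fix z :: 'a
        have "norm (s i z - f z) \<le> norm (s i z) + norm (f z)" by (rule norm_triangle_ineq4)
        also have "norm (s i z) \<le> 2 * norm (f z)" using lim by simp
        finally show "norm (norm (s i z - f z)) \<le> 3 * norm (f z)" by simp
      qed
    qed auto
    hence "\<forall>\<^sub>F i in sequentially. (LINT z|lborel. norm (s i z - f z)) < e / 3"
      using order_tendstoD(2)[of _ 0 sequentially "e / 3"] e by simp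
    then obtain i where i: "(LINT z|lborel. norm (s i z - f z)) < e / 3"
      by (auto simp: eventually_sequentially)
    obtain d where d: "d > 0" "\<And>y. norm y < d \<Longrightarrow> (LINT z|lborel. norm (s i (z + y) - s i z)) < e / 3"
      using lim.IH[of i] e by blast
    have "(LINT z|lborel. norm (f (z + y) - f z)) < e" if y: "norm y < d" for y
    proof -
      have I: "integrable lborel (\<lambda>z. norm (s i z - f z))" using lim by auto
      have J: "integrable lborel (\<lambda>z. norm (s i (z + y) - f (z + y)))"
         "(LINT z|lborel. norm (s i (z + y) - f (z + y))) = (LINT z|lborel. norm (s i z - f z))"
        using integrable_translate[OF I] integral_translate[of "\<lambda>z. norm (s i z - f z)" y] borel_measurable_integrable[OF I] by auto
      have L: "integrable lborel (\<lambda>z. norm (s i (z + y) - s i z))"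
        using lim.hyps(1) integrable_translate by (auto intro!: integrable_norm Bochner_Integration.integrable_diff)
      have "(LINT z|lborel. norm (f (z + y) - f z)) \<le>
        (LINT z|lborel. norm (s i (z + y) - f (z + y)) + norm (s i (z + y) - s i z) + norm (s i z - f z))"
      proof (rule integral_mono_AE')
        show "AE z in lborel. norm (f (z + y) - f z) \<le>
            norm (s i (z + y) - f (z + y)) + norm (s i (z + y) - s i z) + norm (s i z - f z)"
        proof (rule AE_I2)
          fix z
          have eq: "f (z + y) - f z = (s i (z + y) - s i z) + (s i z - f z) - (s i (z + y) - f (z + y))" by simp
          show "norm (f (z + y) - f z) \<le> norm (s i (z + y) - f (z + y)) + norm (s i (z + y) - s i z) + norm (s i z - f z)"
            unfolding eq using norm_triangle_ineq4[of "(s i (z + y) - s i z) + (s i z - f z)" "s i (z + y) - f (z + y)"]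
              norm_triangle_ineq[of "s i (z + y) - s i z" "s i z - f z"] by linarith
        qed
      qed (use I J L in auto)
      also have "\<dots> = (LINT z|lborel. norm (s i (z + y) - f (z + y))) + (LINT z|lborel. norm (s i (z + y) - s i z)) + (LINT z|lborel. norm (s i z - f z))"
        by (simp only: Bochner_Integration.integral_add[OF J(1) L] Bochner_Integration.integral_add[OF Bochner_Integration.integrable_add[OF J(1) L] I])
      also have "\<dots> < e" using i d(2)[OF y] J(2) by simp
      finally show ?thesis .
    qed
    thus "\<exists>d>0. \<forall>y. norm y < d \<longrightarrow> (LINT z|lborel. norm (f (z + y) - f z)) < e"
      using d(1) by blast
  qed
qed

section \<open>Mollification\<close>

lemma dir_deriv_wirtinger:
  assumes "(f has_derivative (\<lambda>h. p * h + q * cnj h)) (at z)"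
  shows "d_xi f z = p" and "d_xibar f z = q"
proof -
  have 1: "dir_deriv 1 f z = p + q" "dir_deriv \<i> f z = \<i> * (p - q)"
    using dir_deriv_eq[OF assms] by (simp_all add: algebra_simps)
  have 2: "\<i> * (\<i> * (p - q)) = q - p" by (simp only: mult.assoc[symmetric] i_squared) simp
  show "d_xi f z = p" "d_xibar f z = q"
    unfolding d_xi_def d_xibar_def 1 2 by simp_all
qed

text \<open>Every real linear map of the complex plane is a combination of \<open>h\<close> and
  \<open>cnj h\<close>, with coefficients determined by its values at 1 and \<i>.\<close>

lemma C1c_test_function:
  assumes "\<eta> \<in> test_functions U"
  shows "C1c \<eta> (d_xi \<eta>) (d_xibar \<eta>)"
proof -
  have C: "C_k (Suc 0) \<eta>" and S: "compact (closure {z. \<eta> z \<noteq> 0})"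
    using assms unfolding test_functions_def by blast+
  have c: "continuous_on UNIV (dir_deriv 1 \<eta>)" "continuous_on UNIV (dir_deriv \<i> \<eta>)"
    using C by auto
  have "(\<eta> has_derivative (\<lambda>h. d_xi \<eta> z * h + d_xibar \<eta> z * cnj h)) (at z)" for z
  proof -
    define D where "D = frechet_derivative \<eta> (at z)"
    have D: "(\<eta> has_derivative D) (at z)"
      using C unfolding D_def by (simp add: frechet_derivative_works[symmetric])
    have bl: "bounded_linear D" using D by (rule has_derivative_bounded_linear)
    have "D h = d_xi \<eta> z * h + d_xibar \<eta> z * cnj h" for h
    proof -
      have "D h = D (Re h *\<^sub>R 1 + Im h *\<^sub>R \<i>)"
        by (rule arg_cong[of _ _ D]) (simp add: complex_eq_iff)
      also have "\<dots> = Re h *\<^sub>R D 1 + Im h *\<^sub>R D \<i>"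
        using bl by (simp add: linear_simps)
      also have "\<dots> = (D 1 - \<i> * D \<i>) / 2 * h + (D 1 + \<i> * D \<i>) / 2 * cnj h"
        by (simp add: complex_eq_iff field_simps)
      finally show ?thesis by (simp add: d_xi_def d_xibar_def dir_deriv_def D_def)
    qed
    hence "D = (\<lambda>h. d_xi \<eta> z * h + d_xibar \<eta> z * cnj h)" by (rule ext)
    with D show ?thesis by simp
  qed
  moreover have "continuous_on UNIV (d_xi \<eta>)" "continuous_on UNIV (d_xibar \<eta>)"
    unfolding d_xi_def[abs_def] d_xibar_def[abs_def] by (intro continuous_intros c; simp)+
  moreover have "\<eta> z = 0" if "z \<notin> closure {z. \<eta> z \<noteq> 0}" for z
    using that closure_subset[of "{z. \<eta> z \<noteq> 0}"] by blast
  ultimately show ?thesis unfolding C1c_def using S by blast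
qed

lemma integrable_mult_C1c:
  assumes "integrable lborel g" and "C1c F p q" and "f \<in> {F, p, q}"
  shows "integrable lborel (\<lambda>w. g w * f (w - z))"
proof -
  obtain S where S: "compact S" "\<And>z. z \<notin> S \<Longrightarrow> F z = 0" "\<And>z. z \<notin> S \<Longrightarrow> p z = 0" "\<And>z. z \<notin> S \<Longrightarrow> q z = 0"
    using C1c_support[OF assms(2)] by metis
  have c: "continuous_on UNIV f"
    using assms(2,3) C1c_continuous[OF assms(2)] unfolding C1c_def by auto
  have "\<And>z. z \<notin> S \<Longrightarrow> f z = 0" using S assms(3) by auto
  then obtain M where M: "M \<ge> 0" "\<And>z. norm (f z) \<le> M"
    using bounded_compact_support[OF c S(1)] by metis
  have [measurable]: "f \<in> borel_measurable borel" using c by (rule borel_measurable_continuous_onI)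
  have [measurable]: "g \<in> borel_measurable borel" using borel_measurable_integrable[OF assms(1)] by simp
  show ?thesis
  proof (rule Bochner_Integration.integrable_bound)
    show "integrable lborel (\<lambda>w. M * norm (g w))" using assms(1) by auto
    show "AE w in lborel. norm (g w * f (w - z)) \<le> norm (M * norm (g w))"
      using mult_right_mono[OF M(2) norm_ge_zero] M(1) by (intro AE_I2) (simp add: norm_mult mult.commute[of "norm (g _)"])
  qed measurable
qed

text \<open>The difference quotients of \<open>\<rho> (w - z)\<close> in \<open>z\<close> have a contribution from \<open>q\<close>, the
  \<open>\<xi>\<close>-bar derivative of \<open>\<rho>\<close>, which is not complex linear in the increment; it is killed
  by the hypothesis on \<open>g\<close>.\<close>

lemma convolution_has_field_derivative:
  assumes g: "integrable lborel g" and \<rho>: "C1c \<rho> p q"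
    and 0: "(LINT w|lborel. g w * q (w - z)) = 0"
  shows "((\<lambda>z. LINT w|lborel. g w * \<rho> (w - z)) has_field_derivative (LINT w|lborel. g w * - p (w - z))) (at z)"
proof -
  have d: "(\<rho> has_derivative (\<lambda>h. p z * h + q z * cnj h)) (at z)" for z
    using \<rho> unfolding C1c_def by auto
  obtain L where L: "L \<ge> 0" "\<And>z w. norm (\<rho> z - \<rho> w) \<le> L * norm (z - w)"
    using C1c_lipschitz[OF \<rho>] by metis
  obtain S where S: "compact S" "\<And>z. z \<notin> S \<Longrightarrow> q z = 0" using C1c_support[OF \<rho>] by metis
  have cq: "continuous_on UNIV q" using \<rho> unfolding C1c_def by auto
  obtain M where M: "M \<ge> 0" "\<And>z. norm (q z) \<le> M"
    using bounded_compact_support[OF cq S] by metis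
  note [measurable] = C1c_measurable[OF \<rho>] C1c_measurable_deriv[OF \<rho>]
  have [measurable]: "g \<in> borel_measurable borel" using borel_measurable_integrable[OF g] by simp
  \<comment> \<open>The added \<open>q y * cnj h\<close> cancels the antilinear part of the
    increment, so the quotient has a complex limit. Integrated against \<open>g\<close>, this
    addition contributes zero by assumption \<open>0\<close>.\<close>
  define R where "R = (\<lambda>y h. (\<rho> (y - h) - \<rho> y + q y * cnj h) / h)"
  have Rlim: "(R y \<longlongrightarrow> - p y) (at 0)" for y
  proof -
    have "((\<lambda>h. \<rho> (y - h)) has_derivative (\<lambda>h. p y * (- h) + q y * cnj (- h))) (at 0)"
      by (rule has_derivative_compose[of "\<lambda>h. y - h" "\<lambda>h. - h" 0 UNIV \<rho> "\<lambda>h. p y * h + q y * cnj h"])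
         (auto intro!: derivative_eq_intros simp: d)
    moreover have "((\<lambda>h. q y * cnj h) has_derivative (\<lambda>h. q y * cnj h)) (at 0)"
      by (intro has_derivative_mult_right has_derivative_cnj has_derivative_ident)
    ultimately have "((\<lambda>h. \<rho> (y - h) + q y * cnj h) has_derivative (\<lambda>h. p y * (- h) + q y * cnj (- h) + q y * cnj h)) (at 0)"
      by (rule has_derivative_add)
    moreover have "(\<lambda>h. p y * (- h) + q y * cnj (- h) + q y * cnj h) = (*) (- p y)"
      by (simp add: fun_eq_iff)
    ultimately have "((\<lambda>h. \<rho> (y - h) + q y * cnj h) has_field_derivative - p y) (at 0)"
      unfolding has_field_derivative_def by (simp only:)
    hence "((\<lambda>h. (\<rho> (y - h) + q y * cnj h - \<rho> y) / h) \<longlongrightarrow> - p y) (at 0)"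
      unfolding DERIV_def by simp
    moreover have "(\<lambda>h. (\<rho> (y - h) + q y * cnj h - \<rho> y) / h) = R y"
      unfolding R_def by (simp add: fun_eq_iff algebra_simps)
    ultimately show ?thesis by simp
  qed
  have Rbound: "norm (R y h) \<le> L + M" if "h \<noteq> 0" for y h
  proof -
    have "norm (\<rho> (y - h) - \<rho> y + q y * cnj h) \<le> norm (\<rho> (y - h) - \<rho> y) + norm (q y * cnj h)"
      by (rule norm_triangle_ineq)
    also have "\<dots> \<le> L * norm h + M * norm h"
      using L(2)[of "y - h" y] M(2)[of y] by (intro add_mono) (auto simp: norm_mult mult_right_mono)
    finally show ?thesis using that unfolding R_def by (simp add: norm_divide divide_simps algebra_simps)
  qed
  have eq: "((LINT w|lborel. g w * \<rho> (w - (z + h))) - (LINT w|lborel. g w * \<rho> (w - z))) / h = (LINT w|lborel. g w * R (w - z) h)"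
    for h
  proof -
    note I = integrable_mult_C1c[OF g \<rho>]
    have "(LINT w|lborel. g w * R (w - z) h) =
      (LINT w|lborel. (g w * \<rho> (w - (z + h)) - g w * \<rho> (w - z) + g w * q (w - z) * cnj h) / h)"
      by (rule Bochner_Integration.integral_cong) (auto simp: R_def algebra_simps)
    also have "\<dots> = (LINT w|lborel. g w * \<rho> (w - (z + h)) - g w * \<rho> (w - z) + g w * q (w - z) * cnj h) / h"
      by (rule integral_divide_zero)
    also have "(LINT w|lborel. g w * \<rho> (w - (z + h)) - g w * \<rho> (w - z) + g w * q (w - z) * cnj h) =
      (LINT w|lborel. g w * \<rho> (w - (z + h))) - (LINT w|lborel. g w * \<rho> (w - z)) + (LINT w|lborel. g w * q (w - z)) * cnj h"
      using I[of \<rho>] I[of q] by simp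
    finally show ?thesis unfolding 0 by simp
  qed
  have "((\<lambda>h. LINT w|lborel. g w * R (w - z) h) \<longlongrightarrow> (LINT w|lborel. g w * - p (w - z))) (at 0)"
    unfolding tendsto_at_iff_sequentially comp_def
  proof (intro allI impI)
    fix X :: "nat \<Rightarrow> complex" assume X: "\<forall>i. X i \<in> UNIV - {0}" "X \<longlonglongrightarrow> 0"
    show "(\<lambda>i. LINT w|lborel. g w * R (w - z) (X i)) \<longlonglongrightarrow> (LINT w|lborel. g w * - p (w - z))"
    proof (rule integral_dominated_convergence)
      show "integrable lborel (\<lambda>w. (L + M) * norm (g w))" using g by auto
      show "AE w in lborel. norm (g w * R (w - z) (X i)) \<le> (L + M) * norm (g w)" for i
      proof (rule AE_I2)
        fix w
        have "norm (R (w - z) (X i)) * norm (g w) \<le> (L + M) * norm (g w)"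
          using Rbound[of "X i" "w - z"] X(1) by (intro mult_right_mono) auto
        thus "norm (g w * R (w - z) (X i)) \<le> (L + M) * norm (g w)" by (simp add: norm_mult mult.commute)
      qed
      have "(\<lambda>i. R (w - z) (X i)) \<longlonglongrightarrow> - p (w - z)" for w
        using Rlim[of "w - z"] X unfolding tendsto_at_iff_sequentially comp_def by blast
      thus "AE w in lborel. (\<lambda>i. g w * R (w - z) (X i)) \<longlonglongrightarrow> g w * - p (w - z)"
        by (intro AE_I2 tendsto_mult tendsto_const)
      show "(\<lambda>w. g w * R (w - z) (X i)) \<in> borel_measurable lborel" for i unfolding R_def by measurable
    qed measurable
  qed
  thus ?thesis unfolding DERIV_def eq .
qed

lemma C1c_bump:
  assumes "d \<ge> 0"
  shows "C1c (bump p c d) (\<lambda>z. - bump (flat_exp_deriv p) c d z * cnj (z - c)) (\<lambda>z. - bump (flat_exp_deriv p) c d z * (z - c))"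
proof -
  have cb: "continuous_on UNIV (bump p c d)" for p by (rule C_k_imp_continuous[OF C_k_bump])
  have "of_real (- 2 * ((z - c) \<bullet> h)) = - (cnj (z - c) * h + (z - c) * cnj h)" for z h
    by (simp only: of_real_mult of_real_inner_complex) simp
  hence "(\<lambda>h. bump (flat_exp_deriv p) c d z * of_real (- 2 * ((z - c) \<bullet> h))) =
      (\<lambda>h. - bump (flat_exp_deriv p) c d z * cnj (z - c) * h + - bump (flat_exp_deriv p) c d z * (z - c) * cnj h)" for z
    by (simp only:) (simp add: fun_eq_iff algebra_simps)
  hence "(bump p c d has_derivative (\<lambda>h. - bump (flat_exp_deriv p) c d z * cnj (z - c) * h + - bump (flat_exp_deriv p) c d z * (z - c) * cnj h)) (at z)" for z
    using bump_has_derivative[of p c d z] by (simp only:)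
  moreover have "continuous_on UNIV (\<lambda>z. - bump (flat_exp_deriv p) c d z * cnj (z - c))"
    "continuous_on UNIV (\<lambda>z. - bump (flat_exp_deriv p) c d z * (z - c))"
    by (intro continuous_intros cb)+
  ultimately show ?thesis unfolding C1c_def using bump_eq_0[OF assms, of _ c p] compact_cball by blast
qed

section \<open>The normalized mollifier\<close>

definition bump_density :: "real \<Rightarrow> complex \<Rightarrow> real" where
  "bump_density d z = flat_exp 1 (d\<^sup>2 - (cmod z)\<^sup>2)"

definition bump_mass :: "real \<Rightarrow> real" where
  "bump_mass d = (LINT z|lborel. bump_density d z)"

text \<open>The kernel is radial, so \<open>w - z\<close> in place of \<open>z - w\<close> still
  gives a convolution.\<close>

definition mollify :: "real \<Rightarrow> (complex \<Rightarrow> complex) \<Rightarrow> complex \<Rightarrow> complex" where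
  "mollify d g z = (LINT w|lborel. g w * bump 1 0 d (w - z)) / of_real (bump_mass d)"

lemma bump_eq_density: "bump 1 0 d z = of_real (bump_density d z)"
  by (simp add: bump_def bump_density_def)

lemma bump_density_nonneg: "bump_density d z \<ge> 0"
  by (simp add: bump_density_def flat_exp_def)

lemma bump_density_eq_0: "d \<ge> 0 \<Longrightarrow> z \<notin> cball 0 d \<Longrightarrow> bump_density d z = 0"
  using bump_eq_0[of d z 0 1] by (simp add: bump_eq_density)

lemma continuous_bump_density: "continuous_on UNIV (bump_density d)"
proof -
  have "continuous_on UNIV (\<lambda>z. Re (bump 1 0 d z))"
    by (intro continuous_intros C_k_imp_continuous[OF C_k_bump])
  thus ?thesis by (simp add: bump_eq_density)
qed

lemma integrable_bump_density: "d \<ge> 0 \<Longrightarrow> integrable lborel (bump_density d)"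
  by (rule integrable_continuous_compact_support[OF continuous_bump_density compact_cball bump_density_eq_0])

text \<open>The density is positive on an open ball, which is not a null set.\<close>

lemma bump_mass_pos:
  assumes "d > 0"
  shows "bump_mass d > 0"
proof -
  have "bump_mass d \<noteq> 0"
  proof
    assume "bump_mass d = 0"
    hence "AE z in lborel. bump_density d z = 0"
      using integral_nonneg_eq_0_iff_AE[OF integrable_bump_density[of d]] assms bump_density_nonneg
      by (simp add: bump_mass_def)
    moreover have "bump_density d z \<noteq> 0" if "z \<in> ball 0 d" for z
    proof -
      have "(cmod z)\<^sup>2 < d\<^sup>2" using that assms by (intro power_strict_mono) auto
      thus ?thesis by (simp add: bump_density_def flat_exp_def)
    qed
    ultimately have "AE z in lborel. z \<notin> ball (0::complex) d"
      by (auto elim: eventually_mono)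
    hence "ball (0::complex) d \<in> null_sets lborel"
      by (subst AE_iff_null_sets) auto
    hence "negligible (ball (0::complex) d)"
      by (simp add: negligible_iff_null_sets null_sets_completionI)
    thus False using open_not_negligible[of "ball (0::complex) d"] assms by simp
  qed
  moreover have "bump_mass d \<ge> 0"
    unfolding bump_mass_def by (rule Bochner_Integration.integral_nonneg) (rule bump_density_nonneg)
  ultimately show ?thesis by simp
qed

text \<open>The xibar derivative of the bump centred at \<open>z\<close> is
  \<open>q (w - z)\<close>, so testing weak holomorphy with this single bump is precisely the
  hypothesis of \<open>convolution_has_field_derivative\<close> at \<open>z\<close>.\<close>

lemma mollify_has_field_derivative:
  assumes g: "integrable lborel g" and hol: "\<And>\<psi>. \<psi> \<in> test_functions U \<Longrightarrow> (LINT z|lborel. g z * d_xibar \<psi> z) = 0"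
    and d: "d \<ge> 0" "cball z d \<subseteq> U"
  shows "\<exists>D. (mollify d g has_field_derivative D) (at z)"
proof -
  define q where "q = (\<lambda>z. - bump (flat_exp_deriv 1) 0 d z * (z - 0))"
  have "d_xibar (bump 1 z d) w = q (w - z)" for w
  proof -
    have "(bump 1 z d has_derivative (\<lambda>h. - bump (flat_exp_deriv 1) z d w * cnj (w - z) * h + - bump (flat_exp_deriv 1) z d w * (w - z) * cnj h)) (at w)"
      using C1c_bump[OF d(1), of 1 z] unfolding C1c_def by blast
    from dir_deriv_wirtinger(2)[OF this] show ?thesis
      unfolding q_def by (simp add: bump_translate[of _ z])
  qed
  hence "(LINT w|lborel. g w * q (w - z)) = 0"
    using hol[OF bump_test_function[OF d, of 1]] by simp
  from DERIV_cdivide[OF convolution_has_field_derivative[OF g C1c_bump[OF d(1), of 1 0, folded q_def] this]]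
  show ?thesis unfolding mollify_def[abs_def] by (rule exI)
qed

text \<open>The normalized kernel has mass 1, so \<open>g z\<close> can be moved under the integral;
  the mollification error becomes an average of translation differences.\<close>

lemma mollify_diff:
  assumes g: "integrable lborel g" and d: "d > 0"
  shows "integrable lborel (\<lambda>y. (g (z + y) - g z) * of_real (bump_density d y / bump_mass d))"
    and "mollify d g z - g z = (LINT y|lborel. (g (z + y) - g z) * of_real (bump_density d y / bump_mass d))"
proof -
  have [measurable]: "g \<in> borel_measurable borel" using borel_measurable_integrable[OF g] by simp
  have [measurable]: "bump_density d \<in> borel_measurable borel" by (rule borel_measurable_continuous_onI[OF continuous_bump_density])
  have N: "bump_mass d \<noteq> 0" using bump_mass_pos[OF d] by simp
  have I: "integrable lborel (\<lambda>w. g w * bump 1 0 d (w - z))"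
    using integrable_mult_C1c[OF g C1c_bump[of d 1 0], of "bump 1 0 d" z] d by simp
  have I2: "integrable lborel (\<lambda>y. g (z + y) * of_real (bump_density d y))"
    "(LINT y|lborel. g (z + y) * of_real (bump_density d y)) = (LINT w|lborel. g w * bump 1 0 d (w - z))"
    using integrable_translate[OF I, of z] integral_translate[of "\<lambda>w. g w * bump 1 0 d (w - z)" z]
    by (simp_all add: add.commute bump_eq_density)
  have I3: "integrable lborel (\<lambda>y. g z * of_real (bump_density d y))"
    using integrable_bump_density[of d] d by (intro integrable_mult_right integrable_of_real) simp
  have I4: "(LINT y|lborel. g z * of_real (bump_density d y)) = g z * of_real (bump_mass d)"
    by (simp add: bump_mass_def)
  have E: "(\<lambda>y. (g (z + y) - g z) * of_real (bump_density d y / bump_mass d)) =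
      (\<lambda>y. (g (z + y) * of_real (bump_density d y) - g z * of_real (bump_density d y)) / of_real (bump_mass d))"
    by (simp add: fun_eq_iff left_diff_distrib diff_divide_distrib)
  show "integrable lborel (\<lambda>y. (g (z + y) - g z) * of_real (bump_density d y / bump_mass d))"
    unfolding E by (intro integrable_divide Bochner_Integration.integrable_diff I2 I3)
  have "(LINT y|lborel. (g (z + y) - g z) * of_real (bump_density d y / bump_mass d)) =
    (LINT y|lborel. (g (z + y) * of_real (bump_density d y) - g z * of_real (bump_density d y)) / of_real (bump_mass d))"
    unfolding E ..
  also have "\<dots> = (LINT y|lborel. g (z + y) * of_real (bump_density d y) - g z * of_real (bump_density d y)) / of_real (bump_mass d)"
    by (rule integral_divide_zero)
  also have "\<dots> = mollify d g z - g z"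
    unfolding Bochner_Integration.integral_diff[OF I2(1) I3] I2(2) I4 mollify_def using N by (simp add: diff_divide_distrib)
  finally show "mollify d g z - g z = (LINT y|lborel. (g (z + y) - g z) * of_real (bump_density d y / bump_mass d))" by simp
qed

lemma mollify_measurable:
  assumes [measurable]: "g \<in> borel_measurable borel"
  shows "mollify d g \<in> borel_measurable borel"
proof -
  have [measurable]: "bump 1 0 d \<in> borel_measurable borel"
    by (rule borel_measurable_continuous_onI[OF C_k_imp_continuous[OF C_k_bump]])
  show ?thesis unfolding mollify_def[abs_def] by measurable
qed

text \<open>Tonelli brings the average over \<open>y\<close> outside, where each translation
  difference costs at most \<open>e\<close>. Nonnegative integrals deliver integrability along with
  the bound.\<close>

lemma mollify_L1_bound:
  assumes g: "integrable lborel g" and d: "d > 0" and e: "e \<ge> 0"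
    and small: "\<And>y. norm y \<le> d \<Longrightarrow> (LINT z|lborel. norm (g (z + y) - g z)) \<le> e"
  shows "integrable lborel (\<lambda>z. mollify d g z - g z)"
    and "(LINT z|lborel. norm (mollify d g z - g z)) \<le> e"
proof -
  have [measurable]: "g \<in> borel_measurable borel" using borel_measurable_integrable[OF g] by simp
  note [measurable] = mollify_measurable[OF this]
  have [measurable]: "bump_density d \<in> borel_measurable borel" by (rule borel_measurable_continuous_onI[OF continuous_bump_density])
  define r where "r = (\<lambda>y. bump_density d y / bump_mass d)"
  have [measurable]: "r \<in> borel_measurable borel" unfolding r_def by measurable
  have r0: "r y \<ge> 0" for y unfolding r_def using bump_density_nonneg[of d y] bump_mass_pos[OF d] by simp
  have r_out: "r y = 0" if "norm y > d" for y unfolding r_def using bump_density_eq_0[of d y] that d by simp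
  have "(\<integral>\<^sup>+y. ennreal (r y) \<partial>lborel) = ennreal (LINT y|lborel. r y)"
    by (rule nn_integral_eq_integral) (use r0 integrable_bump_density[of d] d in \<open>auto simp: r_def\<close>)
  also have "(LINT y|lborel. r y) = 1"
    using bump_mass_pos[OF d] unfolding r_def by (simp add: bump_mass_def[symmetric])
  finally have r1: "(\<integral>\<^sup>+y. ennreal (r y) \<partial>lborel) = 1" by simp
  have "(\<integral>\<^sup>+z. norm (mollify d g z - g z) \<partial>lborel) \<le> (\<integral>\<^sup>+z. (\<integral>\<^sup>+y. ennreal (r y) * ennreal (norm (g (z + y) - g z)) \<partial>lborel) \<partial>lborel)"
  proof (rule nn_integral_mono)
    fix z
    have "ennreal (norm (mollify d g z - g z)) \<le> (\<integral>\<^sup>+y. norm ((g (z + y) - g z) * complex_of_real (r y)) \<partial>lborel)"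
      unfolding mollify_diff(2)[OF g d] r_def
      by (rule integral_norm_bound_ennreal[OF mollify_diff(1)[OF g d]])
    also have "\<dots> = (\<integral>\<^sup>+y. ennreal (r y) * ennreal (norm (g (z + y) - g z)) \<partial>lborel)"
      using r0 by (intro nn_integral_cong) (simp add: norm_mult ennreal_mult'' mult.commute)
    finally show "ennreal (norm (mollify d g z - g z)) \<le> (\<integral>\<^sup>+y. ennreal (r y) * ennreal (norm (g (z + y) - g z)) \<partial>lborel)" .
  qed
  also have "\<dots> = (\<integral>\<^sup>+y. (\<integral>\<^sup>+z. ennreal (r y) * ennreal (norm (g (z + y) - g z)) \<partial>lborel) \<partial>lborel)"
    by (rule lborel_pair.Fubini') measurable
  also have "\<dots> = (\<integral>\<^sup>+y. ennreal (r y) * (\<integral>\<^sup>+z. ennreal (norm (g (z + y) - g z)) \<partial>lborel) \<partial>lborel)"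
    by (intro nn_integral_cong nn_integral_cmult) measurable
  also have "\<dots> \<le> (\<integral>\<^sup>+y. ennreal (r y) * ennreal e \<partial>lborel)"
  proof (rule nn_integral_mono)
    fix y :: complex
    have "(\<integral>\<^sup>+z. ennreal (norm (g (z + y) - g z)) \<partial>lborel) = ennreal (LINT z|lborel. norm (g (z + y) - g z))"
      using integrable_translate[OF g, of y] g by (intro nn_integral_eq_integral) auto
    thus "ennreal (r y) * (\<integral>\<^sup>+z. ennreal (norm (g (z + y) - g z)) \<partial>lborel) \<le> ennreal (r y) * ennreal e"
      using small[of y] r_out[of y] by (cases "norm y \<le> d") (auto intro!: mult_left_mono ennreal_leI)
  qed
  also have "\<dots> = ennreal e" using r1 by (simp add: nn_integral_multc)
  finally have *: "(\<integral>\<^sup>+z. norm (mollify d g z - g z) \<partial>lborel) \<le> ennreal e" .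
  thus I: "integrable lborel (\<lambda>z. mollify d g z - g z)"
    by (intro integrableI_bounded) (auto intro: order.strict_trans1)
  have "ennreal (LINT z|lborel. norm (mollify d g z - g z)) = (\<integral>\<^sup>+z. norm (mollify d g z - g z) \<partial>lborel)"
    using I by (intro nn_integral_eq_integral[symmetric]) auto
  also have "\<dots> \<le> ennreal e" by (rule *)
  finally show "(LINT z|lborel. norm (mollify d g z - g z)) \<le> e"
    using e by (subst (asm) ennreal_le_iff)
qed

section \<open>The estimate for weakly holomorphic quadratic differentials\<close>

lemma integrable_mult_bounded:
  fixes f k :: "'a \<Rightarrow> 'b::{banach, second_countable_topology, real_normed_algebra}"
  assumes "integrable M f" and "k \<in> borel_measurable M" and "\<And>x. norm (k x) \<le> B"
  shows "integrable M (\<lambda>x. f x * k x)"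
proof (rule Bochner_Integration.integrable_bound)
  show "integrable M (\<lambda>x. B * norm (f x))" using assms(1) by auto
  show "AE x in M. norm (f x * k x) \<le> norm (B * norm (f x))"
  proof (rule AE_I2)
    fix x
    have "norm (f x * k x) \<le> norm (f x) * norm (k x)" by (rule norm_mult_ineq)
    also have "\<dots> \<le> norm (f x) * B" using assms(3) by (intro mult_left_mono) auto
    also have "\<dots> \<le> norm (B * norm (f x))" by (simp add: mult.commute)
    finally show "norm (f x * k x) \<le> norm (B * norm (f x))" .
  qed
  show "(\<lambda>x. f x * k x) \<in> borel_measurable M"
    using assms(2) borel_measurable_integrable[OF assms(1)] by (rule borel_measurable_times[rotated])
qed

lemma mollify_holomorphic:
  assumes "integrable lborel g" and "\<And>\<psi>. \<psi> \<in> test_functions U \<Longrightarrow> (LINT z|lborel. g z * d_xibar \<psi> z) = 0"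
    and "d \<ge> 0" "open V" "\<And>z. z \<in> V \<Longrightarrow> cball z d \<subseteq> U"
  shows "mollify d g holomorphic_on V"
  unfolding holomorphic_on_open[OF assms(4)]
  using mollify_has_field_derivative[OF assms(1,2,3) assms(5)] by blast

text \<open>Integrability is global while weak holomorphy is asked only in \<open>U\<close>, so that
  a cut-off of a locally integrable function is admissible as \<open>g\<close>.\<close>

lemma integral_estimate_weakly_holomorphic:
  assumes g: "integrable lborel g" and U: "open U"
    and hol: "\<And>\<psi>. \<psi> \<in> test_functions U \<Longrightarrow> (LINT z|lborel. g z * d_xibar \<psi> z) = 0"
    and \<eta>: "\<eta> \<in> test_functions U"
  shows "cmod (LINT z|lborel. g z * d_xi \<eta> z * d_xibar \<eta> z) \<le> (LINT z|lborel. cmod (g z) * (cmod (d_xibar \<eta> z))\<^sup>2)"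
proof (rule field_le_epsilon)
  fix e :: real assume e: "e > 0"
  define p where "p = d_xi \<eta>"
  define q where "q = d_xibar \<eta>"
  have C: "C1c \<eta> p q" unfolding p_def q_def by (rule C1c_test_function[OF \<eta>])
  define S where "S = closure {z. \<eta> z \<noteq> 0}"
  have S: "compact S" "S \<subseteq> U" using \<eta> unfolding S_def test_functions_def by auto
  have S0: "\<eta> z = 0" if "z \<notin> S" for z
    using that closure_subset[of "{z. \<eta> z \<noteq> 0}"] unfolding S_def by blast
  obtain T where T: "compact T" "\<And>z. z \<notin> T \<Longrightarrow> p z = 0" "\<And>z. z \<notin> T \<Longrightarrow> q z = 0"
    using C1c_support[OF C] by metis
  have cpq: "continuous_on UNIV p" "continuous_on UNIV q" using C unfolding C1c_def by auto
  have [measurable]: "p \<in> borel_measurable borel" "q \<in> borel_measurable borel"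
    using cpq by (auto intro: borel_measurable_continuous_onI)
  obtain A where A: "A \<ge> 0" "\<And>z. cmod (p z) \<le> A" using bounded_compact_support[OF cpq(1) T(1,2)] by metis
  obtain B where B: "B \<ge> 0" "\<And>z. cmod (q z) \<le> B" using bounded_compact_support[OF cpq(2) T(1,3)] by metis
  obtain r where r: "r > 0" "(\<Union>x\<in>S. cball x r) \<subseteq> U"
    using compact_subset_open_imp_cball_epsilon_subset[OF S(1) U S(2)] by metis
  \<comment> \<open>Half the radius leaves room for the mollifier: balls of radius
    \<open>d \<le> r / 2\<close> about points of \<open>V\<close> stay in \<open>U\<close>.\<close>
  define V where "V = (\<Union>x\<in>S. ball x (r / 2))"
  have V: "open V" "S \<subseteq> V" using r(1) unfolding V_def by auto
  \<comment> \<open>An L1 error \<open>e'\<close> changes the left integral by at most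
    \<open>A * B * e'\<close> and the right one by at most \<open>B * B * e'\<close>.\<close>
  define e' where "e' = e / (A * B + B * B + 1)"
  have den: "A * B + B * B + 1 > 0" using A(1) B(1) by (intro add_nonneg_pos add_nonneg_nonneg mult_nonneg_nonneg) auto
  have e': "e' > 0" unfolding e'_def using e den by simp
  obtain d0 where d0: "d0 > 0" "\<And>y. norm y < d0 \<Longrightarrow> (LINT z|lborel. norm (g (z + y) - g z)) < e'"
    using L1_translation_continuous[OF g] e' by blast
  define d where "d = min (d0 / 2) (r / 2)"
  have d: "d > 0" "d < d0" "d \<le> r / 2" using d0(1) r(1) unfolding d_def by auto
  define \<phi> where "\<phi> = mollify d g"
  have small: "(LINT z|lborel. norm (g (z + y) - g z)) \<le> e'" if "norm y \<le> d" for y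
    using d0(2)[of y] that d(2) by simp
  have D: "integrable lborel (\<lambda>z. \<phi> z - g z)" "(LINT z|lborel. norm (\<phi> z - g z)) \<le> e'"
    unfolding \<phi>_def using mollify_L1_bound[OF g d(1) less_imp_le[OF e'] small] by auto
  have hol\<phi>: "\<phi> holomorphic_on V"
    unfolding \<phi>_def
  proof (rule mollify_holomorphic[OF g hol less_imp_le[OF d(1)] V(1)])
    fix z assume "z \<in> V"
    then obtain x where x: "x \<in> S" "dist x z < r / 2" unfolding V_def by auto
    have "cball z d \<subseteq> cball x r"
    proof
      fix y assume "y \<in> cball z d"
      thus "y \<in> cball x r" using dist_triangle[of x y z] x(2) d(3) by simp
    qed
    thus "cball z d \<subseteq> U" using r(2) x(1) by blast
  qed
  have est: "cmod (LINT z|lborel. \<phi> z * p z * q z) \<le> (LINT z|lborel. cmod (\<phi> z) * (cmod (q z))\<^sup>2)"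
    by (rule integral_estimate_holomorphic[OF V(1) hol\<phi> C S(1) V(2) S0])
  have pqb: "norm (p z * q z) \<le> A * B" "norm ((cmod (q z))\<^sup>2) \<le> B * B" for z
    using A B by (auto simp: norm_mult power2_eq_square intro!: mult_mono)
  have I1: "integrable lborel (\<lambda>z. f z * (p z * q z))" if "integrable lborel f" for f
    by (rule integrable_mult_bounded[OF that _ pqb(1)]) measurable
  have I2: "integrable lborel (\<lambda>z. cmod (f z) * (cmod (q z))\<^sup>2)" if "integrable lborel f" for f :: "complex \<Rightarrow> complex"
    by (rule integrable_mult_bounded[OF integrable_norm[OF that] _ pqb(2)]) measurable
  have \<phi>int: "integrable lborel \<phi>"
    using Bochner_Integration.integrable_add[OF D(1) g] by simp
  have "(LINT z|lborel. g z * p z * q z) = (LINT z|lborel. \<phi> z * (p z * q z) - (\<phi> z - g z) * (p z * q z))"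
    by (rule Bochner_Integration.integral_cong) (auto simp: algebra_simps)
  also have "\<dots> = (LINT z|lborel. \<phi> z * (p z * q z)) - (LINT z|lborel. (\<phi> z - g z) * (p z * q z))"
    by (rule Bochner_Integration.integral_diff[OF I1[OF \<phi>int] I1[OF D(1)]])
  finally have "cmod (LINT z|lborel. g z * p z * q z) \<le> cmod (LINT z|lborel. \<phi> z * (p z * q z)) + cmod (LINT z|lborel. (\<phi> z - g z) * (p z * q z))"
    using norm_triangle_ineq4 by metis
  moreover have "cmod (LINT z|lborel. (\<phi> z - g z) * (p z * q z)) \<le> A * B * e'"
  proof -
    have "cmod (LINT z|lborel. (\<phi> z - g z) * (p z * q z)) \<le> (LINT z|lborel. cmod ((\<phi> z - g z) * (p z * q z)))"
      by (rule integral_norm_bound)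
    also have "\<dots> \<le> (LINT z|lborel. cmod (\<phi> z - g z) * (A * B))"
    proof (rule integral_mono)
      show "integrable lborel (\<lambda>z. cmod ((\<phi> z - g z) * (p z * q z)))" by (rule integrable_norm[OF I1[OF D(1)]])
      show "integrable lborel (\<lambda>z. cmod (\<phi> z - g z) * (A * B))" by (rule integrable_mult_left[OF integrable_norm[OF D(1)]])
      show "cmod ((\<phi> z - g z) * (p z * q z)) \<le> cmod (\<phi> z - g z) * (A * B)" for z
        unfolding norm_mult[of "\<phi> z - g z"] by (rule mult_left_mono[OF pqb(1)]) simp
    qed
    also have "\<dots> = (LINT z|lborel. cmod (\<phi> z - g z)) * (A * B)" by (rule integral_mult_left_zero)
    also have "\<dots> \<le> e' * (A * B)" using D(2) A(1) B(1) by (intro mult_right_mono) auto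
    finally show ?thesis by (simp add: mult_ac)
  qed
  moreover have "(LINT z|lborel. cmod (\<phi> z) * (cmod (q z))\<^sup>2) \<le> (LINT z|lborel. cmod (g z) * (cmod (q z))\<^sup>2) + B * B * e'"
  proof -
    have "(LINT z|lborel. cmod (\<phi> z) * (cmod (q z))\<^sup>2) \<le> (LINT z|lborel. cmod (g z) * (cmod (q z))\<^sup>2 + cmod (\<phi> z - g z) * (B * B))"
    proof (rule integral_mono)
      show "integrable lborel (\<lambda>z. cmod (\<phi> z) * (cmod (q z))\<^sup>2)" by (rule I2[OF \<phi>int])
      show "integrable lborel (\<lambda>z. cmod (g z) * (cmod (q z))\<^sup>2 + cmod (\<phi> z - g z) * (B * B))"
        by (intro Bochner_Integration.integrable_add I2[OF g] integrable_mult_left integrable_norm[OF D(1)])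
      fix z
      have "cmod (\<phi> z) \<le> cmod (g z) + cmod (\<phi> z - g z)" using norm_triangle_ineq[of "g z" "\<phi> z - g z"] by simp
      hence "cmod (\<phi> z) * (cmod (q z))\<^sup>2 \<le> (cmod (g z) + cmod (\<phi> z - g z)) * (cmod (q z))\<^sup>2"
        by (intro mult_right_mono) auto
      also have "\<dots> = cmod (g z) * (cmod (q z))\<^sup>2 + cmod (\<phi> z - g z) * (cmod (q z))\<^sup>2"
        by (rule distrib_right)
      also have "\<dots> \<le> cmod (g z) * (cmod (q z))\<^sup>2 + cmod (\<phi> z - g z) * (B * B)"
        using pqb(2)[of z] by (intro add_left_mono mult_left_mono) auto
      finally show "cmod (\<phi> z) * (cmod (q z))\<^sup>2 \<le> cmod (g z) * (cmod (q z))\<^sup>2 + cmod (\<phi> z - g z) * (B * B)" .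
    qed
    also have "\<dots> = (LINT z|lborel. cmod (g z) * (cmod (q z))\<^sup>2) + (LINT z|lborel. cmod (\<phi> z - g z)) * (B * B)"
      using Bochner_Integration.integral_add[OF I2[OF g] integrable_mult_left[OF integrable_norm[OF D(1)]]] by simp
    also have "(LINT z|lborel. cmod (\<phi> z - g z)) * (B * B) \<le> e' * (B * B)"
      using D(2) B(1) by (intro mult_right_mono) auto
    finally show ?thesis by (simp add: mult_ac)
  qed
  moreover have "A * B * e' + B * B * e' \<le> e"
  proof -
    have "A * B * e' + B * B * e' \<le> (A * B + B * B + 1) * e'" using e' by (simp add: algebra_simps)
    also have "\<dots> = e" unfolding e'_def using den by simp
    finally show ?thesis .
  qed
  ultimately show "cmod (LINT z|lborel. g z * d_xi \<eta> z * d_xibar \<eta> z) \<le>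
      (LINT z|lborel. cmod (g z) * (cmod (d_xibar \<eta> z))\<^sup>2) + e"
    using est unfolding p_def[symmetric] q_def[symmetric] mult.assoc by linarith
qed

section \<open>Passage from Lebesgue measure on \<Omega> to Borel functions on the plane\<close>

lemma lebesgue_AE_eq_borel:
  fixes G :: "complex \<Rightarrow> complex"
  assumes "G \<in> borel_measurable lebesgue"
  obtains g where "g \<in> borel_measurable borel" and "AE z in lebesgue. G z = g z"
proof -
  obtain a where a: "a \<in> borel_measurable lborel" "AE z in lborel. Re (G z) = a z"
    using completion_ex_borel_measurable_real[of "\<lambda>z. Re (G z)" lborel] borel_measurable_continuous_on[OF continuous_on_Re[OF continuous_on_id] assms] by blast
  obtain b where b: "b \<in> borel_measurable lborel" "AE z in lborel. Im (G z) = b z"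
    using completion_ex_borel_measurable_real[of "\<lambda>z. Im (G z)" lborel] borel_measurable_continuous_on[OF continuous_on_Im[OF continuous_on_id] assms] by blast
  show thesis
  proof (rule that[of "\<lambda>z. Complex (a z) (b z)"])
    show "(\<lambda>z. Complex (a z) (b z)) \<in> borel_measurable borel"
      using a(1) b(1) unfolding Complex_eq by simp
    show "AE z in lebesgue. G z = Complex (a z) (b z)"
      using AE_completion[OF a(2)] AE_completion[OF b(2)] by eventually_elim (simp add: complex_eq_iff)
  qed
qed

text \<open>Connects the integrals over \<open>lebesgue_on \<Omega>\<close> with the estimates over
  \<open>lborel\<close>: the integrand is cut off at \<open>K\<close> and then replaced by a Borel
  representative.\<close>

lemma integral_lebesgue_on_eq_lborel:
  fixes F :: "complex \<Rightarrow> 'b::{banach, second_countable_topology}"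
  assumes \<Omega>: "\<Omega> \<in> sets lebesgue" and K: "K \<subseteq> \<Omega>"
    and F: "F \<in> borel_measurable (lebesgue_on \<Omega>)" and F0: "\<And>z. z \<in> \<Omega> - K \<Longrightarrow> F z = 0"
    and f: "f \<in> borel_measurable borel"
    and eq: "AE z in lebesgue. indicator K z *\<^sub>R F z = f z"
  shows "(LINT z|lebesgue_on \<Omega>. F z) = (LINT z|lborel. f z)"
proof -
  have E: "(\<lambda>z. indicator \<Omega> z *\<^sub>R F z) = (\<lambda>z. indicator K z *\<^sub>R F z)"
    using K F0 by (auto simp: fun_eq_iff indicator_def)
  have "(LINT z|lebesgue_on \<Omega>. F z) = (LINT z|lebesgue. indicator K z *\<^sub>R F z)"
    using \<Omega> by (subst integral_restrict_space) (simp_all add: E)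
  also have "\<dots> = (LINT z|lebesgue. f z)"
  proof (rule integral_cong_AE)
    show "(\<lambda>z. indicator K z *\<^sub>R F z) \<in> borel_measurable lebesgue"
      using F \<Omega> unfolding E[symmetric] by (subst (asm) borel_measurable_restrict_space_iff) simp_all
    show "f \<in> borel_measurable lebesgue" using f by (intro measurable_completion) simp
  qed (rule eq)
  also have "\<dots> = (LINT z|lborel. f z)" using f by (intro integral_completion) simp
  finally show ?thesis .
qed

theorem theorem1p10:
  fixes \<Omega> :: "complex set" and h \<eta> :: "complex \<Rightarrow> complex"
  assumes "open \<Omega>" and "connected \<Omega>" and "\<Omega> \<noteq> {}"
    and "h \<in> W12_loc \<Omega>"
    and "hopf_harmonic \<Omega> h"
    and "\<eta> \<in> test_functions \<Omega>"
  shows "1 / 2 * (LINT z|lebesgue_on \<Omega>.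
             ((cmod (weak_d_xi \<Omega> h z))\<^sup>2 + (cmod (weak_d_xibar \<Omega> h z))\<^sup>2) * (cmod (d_xibar \<eta> z))\<^sup>2)
         + Re (LINT z|lebesgue_on \<Omega>.
             weak_d_xi \<Omega> h z * cnj (weak_d_xibar \<Omega> h z) * d_xi \<eta> z * d_xibar \<eta> z)
         \<ge> 0"
proof -
  define a where "a = weak_d_xi \<Omega> h"
  define b where "b = weak_d_xibar \<Omega> h"
  define \<phi> where "\<phi> = (\<lambda>z. a z * cnj (b z))"
  define S where "S = closure {z. \<eta> z \<noteq> 0}"
  have S: "compact S" "S \<subseteq> \<Omega>" using assms(6) unfolding S_def test_functions_def by auto
  obtain r where r: "r > 0" "(\<Union>x\<in>S. cball x r) \<subseteq> \<Omega>"
    using compact_subset_open_imp_cball_epsilon_subset[OF S(1) assms(1) S(2)] by metis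
  \<comment> \<open>The Hopf product is only locally integrable, so it is cut off at a compact
    neighbourhood \<open>K\<close> of the support. It stays weakly holomorphic in \<open>U\<close>,
    because derivatives of test functions on \<open>U\<close> vanish off \<open>K\<close>.\<close>
  define K where "K = (\<Union>x\<in>S. cball x r)"
  define U where "U = (\<Union>x\<in>S. ball x r)"
  have K: "compact K" "K \<subseteq> \<Omega>" using r(2) compact_minkowski_sum_cball[OF S(1)] unfolding K_def by auto
  have U: "open U" "S \<subseteq> U" "U \<subseteq> K" using r(1) unfolding U_def K_def by auto
  have \<eta>U: "\<eta> \<in> test_functions U" using assms(6) U(2) unfolding test_functions_def S_def by auto
  have UT: "test_functions U \<subseteq> test_functions \<Omega>" using U(3) K(2) unfolding test_functions_def by auto
  have T0: "d_xi \<psi> z = 0 \<and> d_xibar \<psi> z = 0" if "\<psi> \<in> test_functions U" "z \<notin> K" for \<psi> z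
  proof -
    have sub: "closure {z. \<psi> z \<noteq> 0} \<subseteq> U" using that(1) unfolding test_functions_def by auto
    have "(\<psi> has_derivative (\<lambda>h. d_xi \<psi> z * h + d_xibar \<psi> z * cnj h)) (at z)"
      using C1c_test_function[OF that(1)] unfolding C1c_def by blast
    moreover have "z \<notin> closure {z. \<psi> z \<noteq> 0}" using sub U(3) that(2) by blast
    moreover have "\<psi> z = 0" if "z \<notin> closure {z. \<psi> z \<noteq> 0}" for z
      using that closure_subset[of "{z. \<psi> z \<noteq> 0}"] by blast
    ultimately show ?thesis using wirtinger_zero_outside[OF closed_closure] by blast
  qed
  have \<Omega>s: "\<Omega> \<in> sets lebesgue" using assms(1) by simp
  have Ks: "K \<in> sets lebesgue" using K(1) by (simp add: compact_imp_closed)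
  have L2: "weak_deriv \<Omega> 1 h \<in> L2_loc \<Omega>" "weak_deriv \<Omega> \<i> h \<in> L2_loc \<Omega>"
    using assms(4) unfolding W12_loc_def by auto
  have [measurable]: "weak_deriv \<Omega> 1 h \<in> borel_measurable (lebesgue_on \<Omega>)" "weak_deriv \<Omega> \<i> h \<in> borel_measurable (lebesgue_on \<Omega>)"
    using L2 unfolding L2_loc_def by auto
  have LK: "integrable (lebesgue_on K) (\<lambda>z. (cmod (weak_deriv \<Omega> 1 h z))\<^sup>2)" "integrable (lebesgue_on K) (\<lambda>z. (cmod (weak_deriv \<Omega> \<i> h z))\<^sup>2)"
    using L2 K unfolding L2_loc_def by auto
  have ab[measurable]: "a \<in> borel_measurable (lebesgue_on \<Omega>)" "b \<in> borel_measurable (lebesgue_on \<Omega>)"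
    unfolding a_def b_def weak_d_xi_def[abs_def] weak_d_xibar_def[abs_def] by measurable
  have \<phi>m[measurable]: "\<phi> \<in> borel_measurable (lebesgue_on \<Omega>)" unfolding \<phi>_def
    by (intro borel_measurable_times ab borel_measurable_continuous_on[OF continuous_on_cnj[OF continuous_on_id]])
  have restr: "f \<in> borel_measurable (lebesgue_on K)" if "f \<in> borel_measurable (lebesgue_on \<Omega>)" for f :: "complex \<Rightarrow> 'c::topological_space"
    using measurable_restrict_mono[OF that K(2)] .
  \<comment> \<open>Parallelogram identity: local square integrability passes from the real partial
    derivatives to both Wirtinger derivatives.\<close>
  have "(cmod ((x - \<i> * y) / 2))\<^sup>2 + (cmod ((x + \<i> * y) / 2))\<^sup>2 = ((cmod x)\<^sup>2 + (cmod y)\<^sup>2) / 2" for x y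
    unfolding cmod_power2 by (simp add: power2_eq_square field_simps)
  hence para: "(cmod (a z))\<^sup>2 + (cmod (b z))\<^sup>2 = ((cmod (weak_deriv \<Omega> 1 h z))\<^sup>2 + (cmod (weak_deriv \<Omega> \<i> h z))\<^sup>2) / 2" for z
    unfolding a_def b_def weak_d_xi_def weak_d_xibar_def .
  have abK: "integrable (lebesgue_on K) (\<lambda>z. (cmod (a z))\<^sup>2 + (cmod (b z))\<^sup>2)"
    unfolding para by (intro integrable_divide Bochner_Integration.integrable_add LK)
  have \<phi>le: "2 * cmod (\<phi> z) \<le> (cmod (a z))\<^sup>2 + (cmod (b z))\<^sup>2" for z
    using two_mult_le_sum_squares[of "cmod (a z)" "cmod (b z)"] unfolding \<phi>_def by (simp add: norm_mult)
  have \<phi>K: "integrable (lebesgue_on K) \<phi>"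
  proof (rule Bochner_Integration.integrable_bound[OF abK restr[OF \<phi>m]])
    show "AE z in lebesgue_on K. norm (\<phi> z) \<le> norm ((cmod (a z))\<^sup>2 + (cmod (b z))\<^sup>2)"
    proof (rule AE_I2)
      fix z
      show "norm (\<phi> z) \<le> norm ((cmod (a z))\<^sup>2 + (cmod (b z))\<^sup>2)"
        unfolding real_norm_def using \<phi>le[of z] norm_ge_zero[of "\<phi> z"] by linarith
    qed
  qed
  define G where "G = (\<lambda>z. indicator K z *\<^sub>R \<phi> z)"
  have Gint: "integrable lebesgue G"
    using \<phi>K Ks unfolding G_def by (subst (asm) integrable_restrict_space) simp_all
  obtain g where g[measurable]: "g \<in> borel_measurable borel" and Gg: "AE z in lebesgue. G z = g z"
    using lebesgue_AE_eq_borel[OF borel_measurable_integrable[OF Gint]] by metis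
  have glebm: "g \<in> borel_measurable lebesgue" using g by (intro measurable_completion) simp
  have "integrable lebesgue g"
    using Gint integrable_cong_AE[OF borel_measurable_integrable[OF Gint] glebm Gg] by simp
  hence gint: "integrable lborel g" using integrable_completion[of g lborel] g by simp
  have lm: "k \<in> borel_measurable (lebesgue_on \<Omega>)" if "k \<in> borel_measurable borel" for k :: "complex \<Rightarrow> 'c::topological_space"
    using that by (intro measurable_restrict_space1 measurable_completion) simp
  have transfer: "(LINT z|lebesgue_on \<Omega>. \<phi> z * k z) = (LINT z|lborel. g z * k z)"
    if k[measurable]: "k \<in> borel_measurable borel" and k0: "\<And>z. z \<notin> K \<Longrightarrow> k z = 0" for k
  proof (rule integral_lebesgue_on_eq_lborel[OF \<Omega>s K(2)])
    show "(\<lambda>z. \<phi> z * k z) \<in> borel_measurable (lebesgue_on \<Omega>)" using lm[OF k] \<phi>m by (intro borel_measurable_times)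
    show "AE z in lebesgue. indicator K z *\<^sub>R (\<phi> z * k z) = g z * k z"
      using Gg by eventually_elim (auto simp: G_def indicator_def k0 split: if_splits)
  qed (use k0 in auto)
  have transfer_norm: "(LINT z|lebesgue_on \<Omega>. cmod (\<phi> z) * k z) = (LINT z|lborel. cmod (g z) * k z)"
    if k[measurable]: "k \<in> borel_measurable borel" and k0: "\<And>z. z \<notin> K \<Longrightarrow> k z = 0" for k
  proof (rule integral_lebesgue_on_eq_lborel[OF \<Omega>s K(2)])
    show "(\<lambda>z. cmod (\<phi> z) * k z) \<in> borel_measurable (lebesgue_on \<Omega>)" using lm[OF k] measurable_compose[OF \<phi>m borel_measurable_norm] by (intro borel_measurable_times)
    show "AE z in lebesgue. indicator K z *\<^sub>R (cmod (\<phi> z) * k z) = cmod (g z) * k z"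
      using Gg by eventually_elim (auto simp: G_def indicator_def k0 split: if_splits)
  qed (use k0 in auto)
  have pq: "d_xi \<psi> \<in> borel_measurable borel" "d_xibar \<psi> \<in> borel_measurable borel" if "\<psi> \<in> test_functions U" for \<psi>
    using C1c_measurable_deriv[OF C1c_test_function[OF that]] by auto
  have hol: "(LINT z|lborel. g z * d_xibar \<psi> z) = 0" if "\<psi> \<in> test_functions U" for \<psi>
  proof -
    have "(LINT z|lebesgue_on \<Omega>. \<phi> z * d_xibar \<psi> z) = 0"
      using assms(5) that UT unfolding hopf_harmonic_def \<phi>_def a_def b_def by blast
    thus ?thesis using transfer[OF pq(2)[OF that]] T0[OF that] by simp
  qed
  note est = integral_estimate_weakly_holomorphic[OF gint U(1) hol \<eta>U]
  define p where "p = d_xi \<eta>"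
  define q where "q = d_xibar \<eta>"
  have [measurable]: "p \<in> borel_measurable borel" "q \<in> borel_measurable borel" using pq[OF \<eta>U] unfolding p_def q_def by auto
  have pq0: "z \<notin> K \<Longrightarrow> p z = 0" "z \<notin> K \<Longrightarrow> q z = 0" for z using T0[OF \<eta>U] unfolding p_def q_def by auto
  have "(LINT z|lebesgue_on \<Omega>. \<phi> z * (p z * q z)) = (LINT z|lborel. g z * (p z * q z))"
    by (rule transfer) (simp_all add: pq0)
  moreover have q2: "(\<lambda>z. (cmod (q z))\<^sup>2) \<in> borel_measurable borel" by measurable
  have "(LINT z|lebesgue_on \<Omega>. cmod (\<phi> z) * (cmod (q z))\<^sup>2) = (LINT z|lborel. cmod (g z) * (cmod (q z))\<^sup>2)"
    by (rule transfer_norm[OF q2]) (simp add: pq0)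
  ultimately have est': "cmod (LINT z|lebesgue_on \<Omega>. \<phi> z * (p z * q z)) \<le> (LINT z|lebesgue_on \<Omega>. cmod (\<phi> z) * (cmod (q z))\<^sup>2)"
    using est unfolding p_def[symmetric] q_def[symmetric] mult.assoc by simp
  obtain B where B: "\<And>z. norm ((cmod (q z))\<^sup>2) \<le> B"
  proof -
    have "continuous_on UNIV (\<lambda>z. (cmod (q z))\<^sup>2)"
      using C1c_test_function[OF \<eta>U] unfolding C1c_def q_def by (intro continuous_intros) auto
    from bounded_compact_support[OF this K(1)] pq0(2) that show thesis by (metis norm_zero zero_power2)
  qed
  \<comment> \<open>\<open>q\<close> vanishes off \<open>K\<close>, so integrability on
    \<open>K\<close> is enough on all of \<Omega>.\<close>
  have ext: "integrable (lebesgue_on \<Omega>) (\<lambda>z. f z * (cmod (q z))\<^sup>2)" if f: "integrable (lebesgue_on K) f" for f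
  proof -
    have "integrable (lebesgue_on K) (\<lambda>z. f z * (cmod (q z))\<^sup>2)"
      by (rule integrable_mult_bounded[OF f restr[OF lm[OF q2]] B])
    hence "integrable lebesgue (\<lambda>z. indicator K z *\<^sub>R (f z * (cmod (q z))\<^sup>2))"
      using Ks by (subst (asm) integrable_restrict_space) simp_all
    moreover have "(\<lambda>z. indicator K z *\<^sub>R (f z * (cmod (q z))\<^sup>2)) = (\<lambda>z. indicator \<Omega> z *\<^sub>R (f z * (cmod (q z))\<^sup>2))"
      using K(2) pq0(2) by (auto simp: fun_eq_iff indicator_def)
    ultimately show ?thesis using \<Omega>s by (subst integrable_restrict_space) simp_all
  qed
  have "(LINT z|lebesgue_on \<Omega>. cmod (\<phi> z) * (cmod (q z))\<^sup>2) \<le>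
      (LINT z|lebesgue_on \<Omega>. 1 / 2 * (((cmod (a z))\<^sup>2 + (cmod (b z))\<^sup>2) * (cmod (q z))\<^sup>2))"
  proof (rule integral_mono)
    show "integrable (lebesgue_on \<Omega>) (\<lambda>z. cmod (\<phi> z) * (cmod (q z))\<^sup>2)" by (rule ext[OF integrable_norm[OF \<phi>K]])
    show "integrable (lebesgue_on \<Omega>) (\<lambda>z. 1 / 2 * (((cmod (a z))\<^sup>2 + (cmod (b z))\<^sup>2) * (cmod (q z))\<^sup>2))"
      by (rule integrable_mult_right[OF ext[OF abK]])
    fix z
    have "2 * cmod (\<phi> z) * (cmod (q z))\<^sup>2 \<le> ((cmod (a z))\<^sup>2 + (cmod (b z))\<^sup>2) * (cmod (q z))\<^sup>2"
      by (rule mult_right_mono[OF \<phi>le]) simp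
    thus "cmod (\<phi> z) * (cmod (q z))\<^sup>2 \<le> 1 / 2 * (((cmod (a z))\<^sup>2 + (cmod (b z))\<^sup>2) * (cmod (q z))\<^sup>2)" by simp
  qed
  also have "\<dots> = 1 / 2 * (LINT z|lebesgue_on \<Omega>. ((cmod (a z))\<^sup>2 + (cmod (b z))\<^sup>2) * (cmod (q z))\<^sup>2)"
    by (rule integral_mult_right_zero)
  finally have main: "cmod (LINT z|lebesgue_on \<Omega>. \<phi> z * (p z * q z)) \<le>
     1 / 2 * (LINT z|lebesgue_on \<Omega>. ((cmod (a z))\<^sup>2 + (cmod (b z))\<^sup>2) * (cmod (q z))\<^sup>2)"
    using est' by simp
  have "- Re (LINT z|lebesgue_on \<Omega>. \<phi> z * (p z * q z)) \<le> cmod (LINT z|lebesgue_on \<Omega>. \<phi> z * (p z * q z))"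
    using abs_Re_le_cmod[of "LINT z|lebesgue_on \<Omega>. \<phi> z * (p z * q z)"] by linarith
  with main have "0 \<le> 1 / 2 * (LINT z|lebesgue_on \<Omega>. ((cmod (a z))\<^sup>2 + (cmod (b z))\<^sup>2) * (cmod (q z))\<^sup>2)
     + Re (LINT z|lebesgue_on \<Omega>. \<phi> z * (p z * q z))" by linarith
  thus ?thesis unfolding \<phi>_def a_def b_def p_def q_def by (simp only: mult.assoc)
qed

end
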